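(* Let $\omega$ be an exponential ultrafilter on $\mathbb N$ and let $X$ be a proper metric space with basepoint $x_0$. Then there is an injective continuous map $$\xi:\operatorname{cone}_\omega(X)\setminus\{[x_0]\}\to\nu_LX$$ from the asymptotic cone without its base point to the sublinear Higson corona. Moreover, for every $D>0$, the restriction of $\xi$ to the $D$-annulus $A_D=\dot B_D([x_0])\setminus B_{1/D}([x_0])$ is a topological embedding, where $\dot B$ and $B$ denote closed and open balls in $\operatorname{cone}_\omega(X)$, respectively.
   Context: A metric space is proper if its closed bounded subsets are compact. Exponential ultrafilter: a non-principal ultrafilter $\omega$ on $\mathbb N$ is exponential if it contains the image of a function $f:\mathbb N\to\mathbb N$ such that, for some $a>1$, $f(n+1)\ge af(n)$ for all but finitely many $n$. Asymptotic cone: let $\|x\|=d(x,x_0)$. On the set of sequences $\{x_n\}$ in $X$ for which there is $C$ with $\|x_n\|\le Cn$ for all $n$, put $\{x_n\}\sim\{y_n\}$ iff $\lim_\omega d(x_n,y_n)/n=0$. $\operatorname{cone}_\omega(X)$ is the set of equivalence classes $[\{x_n\}]$ with the metric $d_\omega([\{x_n\}],[\{y_n\}])=\lim_\omega d(x_n,y_n)/n$. All constant sequences are equivalent; their class is the base point $[x_0]$. Sublinear Higson corona: for $E\subset X\times X$ let $E^{-1}=\{(x,y):(y,x)\in E\}$, $E[K]=\{x': (x',x)\in E\text{ for some }x\in K\}$, $E_x=E[\{x\}]$, $E^x=E^{-1}[\{x\}]$. $E$ is proper if $E[K]$ and $E^{-1}[K]$ are relatively compact for each relatively compact $K\subset X$.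 The sublinear coarse structure $\mathcal E_L$ consists of all proper $E\subset X\times X$ with $\lim_{\|x\|\to\infty}\frac{\sup_{y\in E_x}d(y,x)}{\|x\|}=0=\lim_{\|x\|\to\infty}\frac{\sup_{y\in E^x}d(x,y)}{\|x\|}$ (sup over the empty set is $0$; it does not depend on $x_0$). A bounded continuous $f:X\to\mathbb C$ is a Higson function, $f\in C_h(X,\mathcal E_L)$, if for every $E\in\mathcal E_L$ and $\epsilon>0$ there is a compact $K\subset X$ with $|f(x)-f(y)|<\epsilon$ whenever $(y,x)\in E\setminus (K\times K)$. The sublinear Higson compactification $h_LX$ is the compactification of $X$ such that a bounded continuous function $X\to\mathbb C$ extends continuously to $h_LX$ iff it lies in $C_h(X,\mathcal E_L)$; $\nu_LX=h_LX\setminus X$. *)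

theory Defs
  imports "HOL-Analysis.Analysis"
begin

section \<open>Ultrafilters\<close>

definition ultrafilter :: "'i filter \<Rightarrow> bool" where
  "ultrafilter F \<longleftrightarrow> F \<noteq> bot \<and> (\<forall>P. eventually P F \<or> eventually (\<lambda>i. \<not> P i) F)"

definition nonprincipal :: "'i filter \<Rightarrow> bool" where
  "nonprincipal F \<longleftrightarrow> (\<forall>i. \<not> eventually (\<lambda>j. j = i) F)"

definition exponential_ultrafilter :: "nat filter \<Rightarrow> bool" where
  "exponential_ultrafilter \<omega> \<longleftrightarrow>
     ultrafilter \<omega> \<and> nonprincipal \<omega> \<and>
     (\<exists>(f :: nat \<Rightarrow> nat) (a :: real). a > 1 \<and>
        (\<forall>\<^sub>F n in sequentially. real (f (n + 1)) \<ge> a * real (f n)) \<and>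
        eventually (\<lambda>n. n \<in> range f) \<omega>)"

lemma ultrafilter_tendsto_compact:
  assumes "ultrafilter F" "compact S" "eventually (\<lambda>i. f i \<in> S) F"
  shows "\<exists>l\<in>S. (f \<longlongrightarrow> l) F"
proof -
  have nb: "filtermap f F \<noteq> bot"
    using assms(1) by (simp add: ultrafilter_def filtermap_bot_iff)
  have "eventually (\<lambda>x. x \<in> S) (filtermap f F)"
    using assms(3) by (simp add: eventually_filtermap)
  then obtain l where l: "l \<in> S" "inf (nhds l) (filtermap f F) \<noteq> bot"
    using assms(2) nb unfolding compact_filter by blast
  have "filtermap f F \<le> nhds l"
  proof (rule filter_leI)
    fix P assume P: "eventually P (nhds l)"
    show "eventually P (filtermap f F)"
    proof (rule ccontr)
      assume "\<not> eventually P (filtermap f F)"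
      then have "eventually (\<lambda>x. \<not> P x) (filtermap f F)"
        using assms(1) by (auto simp: ultrafilter_def eventually_filtermap)
      with P have "eventually (\<lambda>_. False) (inf (nhds l) (filtermap f F))"
        unfolding eventually_inf by blast
      with l(2) show False by (simp add: trivial_limit_def)
    qed
  qed
  with l(1) show ?thesis by (auto simp: filterlim_def)
qed

lemma ultrafilter_tendsto_bounded:
  fixes f :: "'i \<Rightarrow> real"
  assumes "ultrafilter F" "eventually (\<lambda>i. \<bar>f i\<bar> \<le> B) F"
  shows "(f \<longlongrightarrow> Lim F f) F"
proof -
  have "eventually (\<lambda>i. f i \<in> {-B..B}) F"
    using assms(2) by eventually_elim auto
  then obtain l where "(f \<longlongrightarrow> l) F"
    using ultrafilter_tendsto_compact[OF assms(1) compact_Icc] by blast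
  then show ?thesis
    using assms(1) tendsto_Lim[of F f l] by (simp add: ultrafilter_def)
qed

lemma nonprincipal_pos:
  assumes "ultrafilter \<omega>" "nonprincipal \<omega>"
  shows "eventually (\<lambda>n::nat. n \<ge> 1) \<omega>"
proof -
  have "eventually (\<lambda>n. \<not> n = 0) \<omega>"
    using assms unfolding ultrafilter_def nonprincipal_def by blast
  then show ?thesis by eventually_elim simp
qed


section \<open>Asymptotic cones\<close>

text \<open>
  Sequences are indexed by the positive integers, since constant sequences are to be admissible;
  the value at \<open>0\<close> is unconstrained. It has no influence because \<open>\<omega>\<close> is non-principal.
\<close>

definition cone_seqs :: "'a::metric_space \<Rightarrow> (nat \<Rightarrow> 'a) set" where
  "cone_seqs x0 = {x. \<exists>C. \<forall>n\<ge>1. dist (x n) x0 \<le> C * real n}"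

definition cone_rel :: "nat filter \<Rightarrow> 'a::metric_space \<Rightarrow> ((nat \<Rightarrow> 'a) \<times> (nat \<Rightarrow> 'a)) set" where
  "cone_rel \<omega> x0 = {(x, y). x \<in> cone_seqs x0 \<and> y \<in> cone_seqs x0 \<and>
     ((\<lambda>n. dist (x n) (y n) / real n) \<longlongrightarrow> 0) \<omega>}"

definition asymp_cone :: "nat filter \<Rightarrow> 'a::metric_space \<Rightarrow> (nat \<Rightarrow> 'a) set set" where
  "asymp_cone \<omega> x0 = cone_seqs x0 // cone_rel \<omega> x0"

definition cone_class :: "nat filter \<Rightarrow> 'a::metric_space \<Rightarrow> (nat \<Rightarrow> 'a) \<Rightarrow> (nat \<Rightarrow> 'a) set" where
  "cone_class \<omega> x0 x = cone_rel \<omega> x0 `` {x}"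

definition cone_base :: "nat filter \<Rightarrow> 'a::metric_space \<Rightarrow> (nat \<Rightarrow> 'a) set" where
  "cone_base \<omega> x0 = cone_class \<omega> x0 (\<lambda>_. x0)"

text \<open>The value \<open>0\<close> off the carrier is there because \<^locale>\<open>Metric_space\<close> asks for a total,
  symmetric, nonnegative function. Independence of representatives is
  \<open>cone_dist_class\<close> below.\<close>

definition cone_dist ::
    "nat filter \<Rightarrow> 'a::metric_space \<Rightarrow> (nat \<Rightarrow> 'a) set \<Rightarrow> (nat \<Rightarrow> 'a) set \<Rightarrow> real" where
  "cone_dist \<omega> x0 A B =
     (if A \<in> asymp_cone \<omega> x0 \<and> B \<in> asymp_cone \<omega> x0
      then Lim \<omega> (\<lambda>n. dist ((SOME x. x \<in> A) n) ((SOME y. y \<in> B) n) / real n)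
      else 0)"

definition cone_topology :: "nat filter \<Rightarrow> 'a::metric_space \<Rightarrow> (nat \<Rightarrow> 'a) set topology" where
  "cone_topology \<omega> x0 = Metric_space.mtopology (asymp_cone \<omega> x0) (cone_dist \<omega> x0)"

definition cone_annulus :: "nat filter \<Rightarrow> 'a::metric_space \<Rightarrow> real \<Rightarrow> (nat \<Rightarrow> 'a) set set" where
  "cone_annulus \<omega> x0 D =
     Metric_space.mcball (asymp_cone \<omega> x0) (cone_dist \<omega> x0) (cone_base \<omega> x0) D -
     Metric_space.mball (asymp_cone \<omega> x0) (cone_dist \<omega> x0) (cone_base \<omega> x0) (1 / D)"

lemma const_cone_seqs: "(\<lambda>_. y) \<in> cone_seqs x0"
proof -
  have "dist y x0 \<le> dist y x0 * real n" if "n \<ge> 1" for n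
    using that mult_left_mono[of 1 "real n" "dist y x0"] by simp
  then show ?thesis unfolding cone_seqs_def by blast
qed

context
  fixes \<omega> :: "nat filter" and x0 :: "'a::metric_space"
  assumes uf: "ultrafilter \<omega>" and np: "nonprincipal \<omega>"
begin

lemma cone_limit:
  assumes "x \<in> cone_seqs x0" "y \<in> cone_seqs x0"
  shows "((\<lambda>n. dist (x n) (y n) / real n) \<longlongrightarrow> Lim \<omega> (\<lambda>n. dist (x n) (y n) / real n)) \<omega>"
proof -
  obtain B C where B: "\<forall>n\<ge>1. dist (x n) x0 \<le> B * real n"
    and C: "\<forall>n\<ge>1. dist (y n) x0 \<le> C * real n"
    using assms unfolding cone_seqs_def by blast
  have "eventually (\<lambda>n. \<bar>dist (x n) (y n) / real n\<bar> \<le> B + C) \<omega>"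
    using nonprincipal_pos[OF uf np]
  proof eventually_elim
    case (elim n)
    have "dist (x n) (y n) \<le> dist (x n) x0 + dist (y n) x0"
      by (rule dist_triangle2)
    also have "\<dots> \<le> (B + C) * real n"
      using B C elim by (auto simp: distrib_right intro: add_mono)
    finally show ?case using elim by (simp add: field_simps)
  qed
  then show ?thesis by (rule ultrafilter_tendsto_bounded[OF uf])
qed

lemma cone_limit_eq:
  assumes "((\<lambda>n. dist (x n) (y n) / real n) \<longlongrightarrow> l) \<omega>"
  shows "Lim \<omega> (\<lambda>n. dist (x n) (y n) / real n) = l"
  using uf assms by (intro tendsto_Lim) (auto simp: ultrafilter_def)

lemma cone_rel_equiv: "equiv (cone_seqs x0) (cone_rel \<omega> x0)"
proof (rule equivI)
  show "cone_rel \<omega> x0 \<subseteq> cone_seqs x0 \<times> cone_seqs x0"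
    by (auto simp: cone_rel_def)
  show "refl_on (cone_seqs x0) (cone_rel \<omega> x0)"
    by (auto simp: refl_on_def cone_rel_def)
  show "sym (cone_rel \<omega> x0)"
    by (auto simp: sym_def cone_rel_def dist_commute)
  show "trans (cone_rel \<omega> x0)"
  proof (rule transI)
    fix x y z assume xy: "(x, y) \<in> cone_rel \<omega> x0" and yz: "(y, z) \<in> cone_rel \<omega> x0"
    have *: "((\<lambda>n. dist (x n) (y n) / real n + dist (y n) (z n) / real n) \<longlongrightarrow> 0) \<omega>"
      using xy yz tendsto_add[of _ 0 \<omega> _ 0] by (auto simp: cone_rel_def)
    have "((\<lambda>n. dist (x n) (z n) / real n) \<longlongrightarrow> 0) \<omega>"
    proof (rule tendsto_sandwich[OF _ _ tendsto_const *])
      show "\<forall>\<^sub>F n in \<omega>. dist (x n) (z n) / real n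
              \<le> dist (x n) (y n) / real n + dist (y n) (z n) / real n"
        by (intro always_eventually allI)
           (simp flip: add_divide_distrib add: divide_right_mono dist_triangle)
    qed simp
    with xy yz show "(x, z) \<in> cone_rel \<omega> x0" by (auto simp: cone_rel_def)
  qed
qed

lemma cone_rel_Lim:
  assumes "(x, x') \<in> cone_rel \<omega> x0" "(y, y') \<in> cone_rel \<omega> x0"
  shows "Lim \<omega> (\<lambda>n. dist (x n) (y n) / real n) \<le> Lim \<omega> (\<lambda>n. dist (x' n) (y' n) / real n)"
proof -
  let ?d = "\<lambda>u v n. dist (u n) (v n) / real n"
  have mem: "x \<in> cone_seqs x0" "x' \<in> cone_seqs x0" "y \<in> cone_seqs x0" "y' \<in> cone_seqs x0"
    and lims: "(?d x x' \<longlongrightarrow> 0) \<omega>" "(?d y y' \<longlongrightarrow> 0) \<omega>"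
    using assms by (auto simp: cone_rel_def)
  have r: "((\<lambda>n. ?d x x' n + ?d x' y' n + ?d y y' n) \<longlongrightarrow> 0 + Lim \<omega> (?d x' y') + 0) \<omega>"
    by (intro tendsto_add lims cone_limit mem)
  have ev: "\<forall>\<^sub>F n in \<omega>. ?d x y n \<le> ?d x x' n + ?d x' y' n + ?d y y' n"
  proof (intro always_eventually allI)
    fix n
    have "dist (x n) (y n) \<le> dist (x n) (x' n) + dist (x' n) (y' n) + dist (y n) (y' n)"
      using dist_triangle[of "x n" "y n" "x' n"] dist_triangle2[of "x' n" "y n" "y' n"] by linarith
    then show "?d x y n \<le> ?d x x' n + ?d x' y' n + ?d y y' n"
      by (simp flip: add_divide_distrib add: divide_right_mono)
  qed
  have "\<omega> \<noteq> bot" using uf by (simp add: ultrafilter_def)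
  from tendsto_le[OF this r cone_limit[OF mem(1,3)] ev] show ?thesis by simp
qed

lemma cone_class_in: "x \<in> cone_seqs x0 \<Longrightarrow> cone_class \<omega> x0 x \<in> asymp_cone \<omega> x0"
  unfolding cone_class_def asymp_cone_def by (rule quotientI)

lemma asymp_coneE:
  assumes "A \<in> asymp_cone \<omega> x0"
  obtains x where "x \<in> cone_seqs x0" "A = cone_class \<omega> x0 x"
  using assms unfolding cone_class_def asymp_cone_def by (auto elim: quotientE)

lemma cone_class_eq_iff:
  assumes "x \<in> cone_seqs x0" "y \<in> cone_seqs x0"
  shows "cone_class \<omega> x0 x = cone_class \<omega> x0 y
           \<longleftrightarrow> ((\<lambda>n. dist (x n) (y n) / real n) \<longlongrightarrow> 0) \<omega>"
  using eq_equiv_class_iff[OF cone_rel_equiv assms] assms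
  by (simp add: cone_class_def cone_rel_def)

lemma cone_class_const: "cone_class \<omega> x0 (\<lambda>_. y) = cone_base \<omega> x0"
proof -
  have fin: "eventually (\<lambda>n. n \<ge> N) \<omega>" for N :: nat
  proof (induction N)
    case (Suc N)
    have "eventually (\<lambda>n. \<not> n = N) \<omega>"
      using uf np unfolding ultrafilter_def nonprincipal_def by blast
    with Suc show ?case by eventually_elim simp
  qed simp
  then have "\<omega> \<le> sequentially"
    by (auto simp: le_sequentially)
  moreover have "((\<lambda>n. dist y x0 / real n) \<longlongrightarrow> 0) sequentially"
    by (rule lim_const_over_n)
  ultimately have "((\<lambda>n. dist y x0 / real n) \<longlongrightarrow> 0) \<omega>"
    by (rule tendsto_mono)
  then show ?thesis
    unfolding cone_base_def by (subst cone_class_eq_iff) (auto simp: const_cone_seqs)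
qed

lemma cone_dist_class:
  assumes "x \<in> cone_seqs x0" "y \<in> cone_seqs x0"
  shows "cone_dist \<omega> x0 (cone_class \<omega> x0 x) (cone_class \<omega> x0 y)
           = Lim \<omega> (\<lambda>n. dist (x n) (y n) / real n)"
proof -
  have some: "(z, SOME u. u \<in> cone_class \<omega> x0 z) \<in> cone_rel \<omega> x0" if "z \<in> cone_seqs x0" for z
  proof -
    have "z \<in> cone_class \<omega> x0 z"
      using equiv_class_self[OF cone_rel_equiv that] by (simp add: cone_class_def)
    then have "(SOME u. u \<in> cone_class \<omega> x0 z) \<in> cone_class \<omega> x0 z"
      by (rule someI[where P="\<lambda>u. u \<in> cone_class \<omega> x0 z"])
    then show ?thesis by (simp add: cone_class_def)
  qed
  have sym: "sym (cone_rel \<omega> x0)" using cone_rel_equiv by (rule equivE)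
  show ?thesis
    using cone_rel_Lim[OF some[OF assms(1)] some[OF assms(2)]]
      cone_rel_Lim[OF symD[OF sym some[OF assms(1)]] symD[OF sym some[OF assms(2)]]]
    by (simp add: cone_dist_def cone_class_in assms)
qed

lemma Metric_space_cone: "Metric_space (asymp_cone \<omega> x0) (cone_dist \<omega> x0)"
proof
  have bot: "\<omega> \<noteq> bot" using uf by (simp add: ultrafilter_def)
  fix A B C
  show "0 \<le> cone_dist \<omega> x0 A B"
  proof (cases "A \<in> asymp_cone \<omega> x0 \<and> B \<in> asymp_cone \<omega> x0")
    case True
    then obtain x y where xy: "x \<in> cone_seqs x0" "y \<in> cone_seqs x0"
      "A = cone_class \<omega> x0 x" "B = cone_class \<omega> x0 y"
      by (metis asymp_coneE)
    show ?thesis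
      using tendsto_lowerbound[OF cone_limit[OF xy(1,2)] _ bot, of 0] xy
      by (simp add: cone_dist_class)
  qed (auto simp: cone_dist_def)
  show "cone_dist \<omega> x0 A B = cone_dist \<omega> x0 B A"
    by (auto simp: cone_dist_def dist_commute)
  assume A: "A \<in> asymp_cone \<omega> x0" and B: "B \<in> asymp_cone \<omega> x0"
  from A B obtain x y where xy: "x \<in> cone_seqs x0" "y \<in> cone_seqs x0"
    "A = cone_class \<omega> x0 x" "B = cone_class \<omega> x0 y"
    by (metis asymp_coneE)
  show "cone_dist \<omega> x0 A B = 0 \<longleftrightarrow> A = B"
  proof
    assume "cone_dist \<omega> x0 A B = 0"
    then show "A = B"
      using cone_limit[OF xy(1,2)] xy by (simp add: cone_dist_class cone_class_eq_iff)
  next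
    assume "A = B"
    then have "((\<lambda>n. dist (x n) (y n) / real n) \<longlongrightarrow> 0) \<omega>"
      using cone_class_eq_iff[OF xy(1,2)] xy by simp
    then show "cone_dist \<omega> x0 A B = 0"
      using xy cone_limit_eq by (simp add: cone_dist_class)
  qed
  assume "C \<in> asymp_cone \<omega> x0"
  then obtain z where z: "z \<in> cone_seqs x0" "C = cone_class \<omega> x0 z"
    by (metis asymp_coneE)
  have "Lim \<omega> (\<lambda>n. dist (x n) (z n) / real n)
      \<le> Lim \<omega> (\<lambda>n. dist (x n) (y n) / real n) + Lim \<omega> (\<lambda>n. dist (y n) (z n) / real n)"
    by (rule tendsto_le[OF bot tendsto_add[OF cone_limit cone_limit] cone_limit])
       (auto simp: xy z simp flip: add_divide_distrib
             intro!: always_eventually divide_right_mono dist_triangle)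
  then show "cone_dist \<omega> x0 A C \<le> cone_dist \<omega> x0 A B + cone_dist \<omega> x0 B C"
    using xy z by (simp add: cone_dist_class)
qed

end


section \<open>The sublinear coarse structure and its Higson compactification\<close>

definition entourage_image :: "('a \<times> 'a) set \<Rightarrow> 'a set \<Rightarrow> 'a set" where
  "entourage_image E K = {x'. \<exists>x\<in>K. (x', x) \<in> E}"

definition proper_entourage :: "('a::topological_space \<times> 'a) set \<Rightarrow> bool" where
  "proper_entourage E \<longleftrightarrow>
     (\<forall>K. compact (closure K) \<longrightarrow>
        compact (closure (entourage_image E K)) \<and> compact (closure (entourage_image (E\<inverse>) K)))"

definition sup_dist :: "'a::metric_space set \<Rightarrow> 'a \<Rightarrow> real" where
  "sup_dist S x = (if S = {} then 0 else SUP y\<in>S. dist y x)"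

text \<open>For proper \<open>E\<close> the sets \<open>E\<^sub>x\<close> and \<open>E\<^sup>x\<close> are relatively compact, so the suprema are finite.
  The filter is the one for \<open>dist x x0\<close> tending to infinity.\<close>

definition sublinear_coarse :: "'a::metric_space \<Rightarrow> ('a \<times> 'a) set set" where
  "sublinear_coarse x0 = {E. proper_entourage E \<and>
     ((\<lambda>x. sup_dist (entourage_image E {x}) x / dist x x0) \<longlongrightarrow> 0)
       (filtercomap (\<lambda>x. dist x x0) at_top) \<and>
     ((\<lambda>x. sup_dist (entourage_image (E\<inverse>) {x}) x / dist x x0) \<longlongrightarrow> 0)
       (filtercomap (\<lambda>x. dist x x0) at_top)}"

definition higson_functions :: "'a::metric_space \<Rightarrow> ('a \<Rightarrow> complex) set" where
  "higson_functions x0 = {f. continuous_on UNIV f \<and> bounded (range f) \<and>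
     (\<forall>E\<in>sublinear_coarse x0. \<forall>\<epsilon>>0. \<exists>K. compact K \<and>
        (\<forall>x y. (y, x) \<in> E - K \<times> K \<longrightarrow> cmod (f x - f y) < \<epsilon>))}"

definition compactification :: "'b topology \<Rightarrow> ('a::topological_space \<Rightarrow> 'b) \<Rightarrow> bool" where
  "compactification hX \<iota> \<longleftrightarrow>
     compact_space hX \<and> Hausdorff_space hX \<and> embedding_map euclidean hX \<iota> \<and>
     hX closure_of (range \<iota>) = topspace hX"

text \<open>The defining property of \<open>h\<^sub>LX\<close>, which determines it up to homeomorphism over \<open>X\<close>;
  \<open>higson_compactification_exists\<close> below provides a model.\<close>

definition sublinear_higson_compactification ::
    "'a::metric_space \<Rightarrow> 'b topology \<Rightarrow> ('a \<Rightarrow> 'b) \<Rightarrow> bool" where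
  "sublinear_higson_compactification x0 hX \<iota> \<longleftrightarrow>
     compactification hX \<iota> \<and>
     (\<forall>f :: 'a \<Rightarrow> complex. continuous_on UNIV f \<and> bounded (range f) \<longrightarrow>
        ((\<exists>F. continuous_map hX euclidean F \<and> (\<forall>x. F (\<iota> x) = f x)) \<longleftrightarrow> f \<in> higson_functions x0))"

definition corona :: "'b topology \<Rightarrow> ('a \<Rightarrow> 'b) \<Rightarrow> 'b topology" where
  "corona hX \<iota> = subtopology hX (topspace hX - range \<iota>)"

lemma compact_support_higson:
  fixes x0 :: "'a::metric_space" and f :: "'a \<Rightarrow> complex"
  assumes cont: "continuous_on UNIV f" and K0: "compact K0" and supp: "\<And>x. x \<notin> K0 \<Longrightarrow> f x = 0"
  shows "f \<in> higson_functions x0"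
proof -
  have "compact (f ` K0)"
    using cont K0 by (meson compact_continuous_image continuous_on_subset subset_UNIV)
  then have "bounded (insert 0 (f ` K0))" by (simp add: compact_imp_bounded)
  moreover have "range f \<subseteq> insert 0 (f ` K0)" using supp by auto
  ultimately have bdd: "bounded (range f)" by (rule bounded_subset)
  have "\<exists>K. compact K \<and> (\<forall>x y. (y, x) \<in> E - K \<times> K \<longrightarrow> cmod (f x - f y) < \<epsilon>)"
    if E: "E \<in> sublinear_coarse x0" and e: "\<epsilon> > 0" for E \<epsilon>
  proof -
    let ?K = "K0 \<union> closure (entourage_image E K0) \<union> closure (entourage_image (E\<inverse>) K0)"
    have "compact (closure K0)" using K0 by (simp add: compact_imp_closed)
    then have "compact ?K"
      using E K0 by (auto simp: sublinear_coarse_def proper_entourage_def intro!: compact_Un)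
    moreover have "cmod (f x - f y) < \<epsilon>" if "(y, x) \<in> E - ?K \<times> ?K" for x y
    proof -
      have "x \<notin> K0"
      proof
        assume "x \<in> K0"
        then have "y \<in> entourage_image E K0" using that by (auto simp: entourage_image_def)
        then have "y \<in> ?K" using closure_subset by blast
        with \<open>x \<in> K0\<close> that show False by blast
      qed
      moreover have "y \<notin> K0"
      proof
        assume "y \<in> K0"
        then have "x \<in> entourage_image (E\<inverse>) K0" using that by (auto simp: entourage_image_def)
        then have "x \<in> ?K" using closure_subset by blast
        with \<open>y \<in> K0\<close> that show False by blast
      qed
      ultimately show ?thesis using supp e by simp
    qed
    ultimately show ?thesis by blast
  qed
  then show ?thesis using cont bdd by (simp add: higson_functions_def)
qed

lemma bump_higson:
  fixes x0 x :: "'a::metric_space"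
  assumes proper: "\<forall>S :: 'a set. closed S \<and> bounded S \<longrightarrow> compact S" and r: "r > 0"
  shows "(\<lambda>y. complex_of_real (max 0 (1 - dist x y / r))) \<in> higson_functions x0"
proof (rule compact_support_higson)
  show "compact (cball x r)" using proper by simp
  show "continuous_on UNIV (\<lambda>y. complex_of_real (max 0 (1 - dist x y / r)))"
    using r by (intro continuous_intros) auto
  show "complex_of_real (max 0 (1 - dist x y / r)) = 0" if "y \<notin> cball x r" for y
    using that r by (auto simp: field_simps max_def)
qed

lemma higson_compactification_exists:
  fixes x0 :: "'a::metric_space"
  assumes proper: "\<forall>S :: 'a set. closed S \<and> bounded S \<longrightarrow> compact S"
  shows "\<exists>(hX :: (('a \<Rightarrow> complex) \<Rightarrow> complex) topology) \<iota>. sublinear_higson_compactification x0 hX \<iota>"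
proof -
  define H where "H = higson_functions x0"
  define P where "P = product_topology (\<lambda>f. top_of_set (closure (range f))) H"
  define e :: "'a \<Rightarrow> ('a \<Rightarrow> complex) \<Rightarrow> complex" where "e = (\<lambda>x. \<lambda>f\<in>H. f x)"
  define hX where "hX = subtopology P (P closure_of (range e))"
  have Hc: "continuous_on UNIV f" and Hb: "bounded (range f)" if "f \<in> H" for f
    using that by (auto simp: H_def higson_functions_def)
  have "compact_space P"
    unfolding P_def compact_space_product_topology
    using Hb by (auto simp: compact_space_subtopology compactin_euclidean_iff compact_closure)
  have hausP: "Hausdorff_space P"
    unfolding P_def Hausdorff_space_product_topology
    by (auto simp: Hausdorff_space_subtopology Hausdorff_space_euclidean)
  have ePmap: "continuous_map euclidean P e"
    unfolding P_def e_def continuous_map_componentwise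
    using Hc closure_subset by (fastforce simp: continuous_map_in_subtopology)
  have eP: "range e \<subseteq> topspace P"
    using ePmap by (auto simp: continuous_map_def)
  have tophX: "topspace hX = P closure_of (range e)"
    unfolding hX_def by (simp add: closure_of_subset_topspace inf_absorb2)
  have esub: "range e \<subseteq> topspace hX"
    unfolding tophX using eP by (rule closure_of_subset)
  have comp: "compact_space hX"
    unfolding hX_def
    by (intro compact_space_subtopology closedin_compact_space \<open>compact_space P\<close> closedin_closure_of)
  have haus: "Hausdorff_space hX"
    unfolding hX_def by (intro Hausdorff_space_subtopology hausP)
  have dense: "hX closure_of (range e) = topspace hX"
    using esub unfolding tophX hX_def
    by (simp add: closure_of_subtopology inf_absorb2 closure_of_subset_topspace)
  have emap: "continuous_map euclidean hX e"
    using ePmap esub unfolding hX_def tophX by (auto simp: continuous_map_in_subtopology)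
  have proj: "continuous_map hX euclidean (\<lambda>p. p f)" if "f \<in> H" for f
  proof -
    have "continuous_map P (top_of_set (closure (range f))) (\<lambda>p. p f)"
      unfolding P_def by (rule continuous_map_product_projection[OF that])
    then show ?thesis
      unfolding hX_def by (simp add: continuous_map_from_subtopology continuous_map_in_subtopology)
  qed
  have bump: "\<exists>f\<in>H. f x \<noteq> 0 \<and> (\<forall>y. f y \<noteq> 0 \<longrightarrow> y \<in> U)" if "open U" "x \<in> U" for x U
  proof -
    obtain r where r: "r > 0" "ball x r \<subseteq> U" using \<open>open U\<close> \<open>x \<in> U\<close> open_contains_ball by blast
    have "y \<in> U" if "max 0 (1 - dist x y / r) \<noteq> 0" for y
    proof -
      have "dist x y < r" using that r(1) by (auto simp: max_def field_simps split: if_splits)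
      then show ?thesis using r(2) by auto
    qed
    then show ?thesis
      using bump_higson[OF proper r(1), of x x0] unfolding H_def[symmetric]
      by (intro bexI[where x="\<lambda>y. complex_of_real (max 0 (1 - dist x y / r))"]) auto
  qed
  have inj: "inj e"
  proof (rule injI, rule ccontr)
    fix x y assume xy: "e x = e y" "x \<noteq> y"
    obtain f where f: "f \<in> H" "f x \<noteq> 0" "\<forall>z. f z \<noteq> 0 \<longrightarrow> z \<in> - {y}"
      using bump[of "- {y}" x] xy(2) by auto
    have "f x = f y" using fun_cong[OF xy(1), of f] f(1) by (simp add: e_def)
    with f show False by auto
  qed
  have emb: "embedding_map euclidean hX e"
  proof -
    have "open_map euclidean (subtopology hX (range e)) e"
      unfolding open_map_def
    proof (intro allI impI)
      fix U :: "'a set" assume "openin euclidean U"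
      then have U: "open U" by simp
      show "openin (subtopology hX (range e)) (e ` U)"
      proof (subst openin_subopen, intro ballI)
        fix p assume "p \<in> e ` U"
        then obtain x where x: "x \<in> U" "p = e x" by blast
        obtain f where f: "f \<in> H" "f x \<noteq> 0" "\<forall>y. f y \<noteq> 0 \<longrightarrow> y \<in> U"
          using bump[OF U x(1)] by blast
        let ?W = "{p \<in> topspace hX. p f \<in> - {0}}"
        have "openin hX ?W"
          by (rule openin_continuous_map_preimage[OF proj[OF f(1)]]) auto
        then have "openin (subtopology hX (range e)) (range e \<inter> ?W)"
          by (simp add: openin_subtopology_Int2)
        moreover have "p \<in> range e \<inter> ?W"
          using x f esub by (auto simp: e_def)
        moreover have "range e \<inter> ?W \<subseteq> e ` U"
          using f by (auto simp: e_def)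
        ultimately show "\<exists>T. openin (subtopology hX (range e)) T \<and> p \<in> T \<and> T \<subseteq> e ` U"
          by blast
      qed
    qed
    then have "homeomorphic_map euclidean (subtopology hX (range e)) e"
      using emap inj esub
      by (intro bijective_open_imp_homeomorphic_map)
         (auto simp: continuous_map_in_subtopology)
    then show ?thesis by (simp add: embedding_map_def)
  qed
  have ext: "(\<exists>F. continuous_map hX euclidean F \<and> (\<forall>x. F (e x) = f x)) \<longleftrightarrow> f \<in> H"
    if f: "continuous_on UNIV f" "bounded (range f)" for f :: "'a \<Rightarrow> complex"
  proof
    assume "f \<in> H"
    then show "\<exists>F. continuous_map hX euclidean F \<and> (\<forall>x. F (e x) = f x)"
      using proj by (intro exI[where x="\<lambda>p. p f"]) (auto simp: e_def)
  next
    assume "\<exists>F. continuous_map hX euclidean F \<and> (\<forall>x. F (e x) = f x)"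
    then obtain F where F: "continuous_map hX euclidean F" "\<And>x. F (e x) = f x" by blast
    have "\<exists>K. compact K \<and> (\<forall>x y. (y, x) \<in> E - K \<times> K \<longrightarrow> cmod (f x - f y) < \<epsilon>)"
      if E: "E \<in> sublinear_coarse x0" and eps: "\<epsilon> > 0" for E \<epsilon>
    proof -
      let ?Q = "prod_topology hX hX"
      have diff: "continuous_map ?Q euclidean (\<lambda>z. cmod (G (fst z) - G (snd z)))"
        if "continuous_map hX euclidean G" for G :: "(('a \<Rightarrow> complex) \<Rightarrow> complex) \<Rightarrow> complex"
        using continuous_map_compose[OF continuous_map_fst that]
          continuous_map_compose[OF continuous_map_snd that]
        by (intro continuous_map_norm continuous_map_diff) (auto simp: o_def)
      let ?Z = "{z \<in> topspace ?Q. cmod (F (fst z) - F (snd z)) \<in> {\<epsilon>..}}"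
      have "closedin ?Q ?Z"
        by (rule closedin_continuous_map_preimage[OF diff[OF F(1)]]) auto
      moreover have "compact_space ?Q" using comp by (simp add: compact_space_prod_topology)
      ultimately have cZ: "compactin ?Q ?Z" by (simp add: closedin_compact_space)
      let ?V = "\<lambda>(g, n). {z \<in> topspace ?Q. cmod (fst z g - snd z g) \<in> {inverse (real (Suc n))<..}}"
      let ?I = "H \<times> (UNIV :: nat set)"
      have Vo: "openin ?Q (?V i)" if "i \<in> ?I" for i
      proof -
        obtain g n where i: "i = (g, n)" "g \<in> H" using \<open>i \<in> ?I\<close> by auto
        show ?thesis
          unfolding i(1) split
          by (rule openin_continuous_map_preimage[OF diff[OF proj[OF i(2)]]]) auto
      qed
      have Zc: "?Z \<subseteq> \<Union> (?V ` ?I)"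
      proof
        fix z assume z: "z \<in> ?Z"
        obtain p q where pq: "z = (p, q)" by (cases z)
        have "p \<noteq> q" using z eps pq by auto
        moreover have "p \<in> extensional H" "q \<in> extensional H"
          using z pq closure_of_subset_topspace[of P "range e"]
          unfolding tophX topspace_prod_topology
          by (auto simp: P_def PiE_def)
        ultimately obtain g where g: "g \<in> H" "p g \<noteq> q g"
          by (meson extensionalityI)
        then obtain n where "inverse (real (Suc n)) < cmod (p g - q g)"
          using reals_Archimedean[of "cmod (p g - q g)"] by auto
        then have "z \<in> ?V (g, n)" using z pq by auto
        with g(1) show "z \<in> \<Union> (?V ` ?I)" by blast
      qed
      have "\<And>U. U \<in> ?V ` ?I \<Longrightarrow> openin ?Q U"
        using Vo by blast
      from compactinD[OF cZ this Zc]
      obtain \<F> where "finite \<F>" "\<F> \<subseteq> ?V ` ?I" "?Z \<subseteq> \<Union> \<F>"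
        by blast
      then obtain J where J: "finite J" "J \<subseteq> ?I" "?Z \<subseteq> \<Union> (?V ` J)"
        using finite_subset_image[of \<F> ?V ?I] by blast
      have "\<forall>i\<in>J. \<exists>K. compact K \<and>
          (\<forall>x y. (y, x) \<in> E - K \<times> K \<longrightarrow> cmod (fst i x - fst i y) < inverse (real (Suc (snd i))))"
      proof
        fix i assume "i \<in> J"
        then have "fst i \<in> higson_functions x0" using J(2) by (auto simp: H_def)
        then show "\<exists>K. compact K \<and>
          (\<forall>x y. (y, x) \<in> E - K \<times> K \<longrightarrow> cmod (fst i x - fst i y) < inverse (real (Suc (snd i))))"
          using E unfolding higson_functions_def by auto
      qed
      then obtain K where K: "\<And>i. i \<in> J \<Longrightarrow> compact (K i)"
        "\<And>i x y. i \<in> J \<Longrightarrow> (y, x) \<in> E - K i \<times> K i \<Longrightarrow>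
           cmod (fst i x - fst i y) < inverse (real (Suc (snd i)))"
        by metis
      have "compact (\<Union>i\<in>J. K i)" using J(1) K(1) by (rule compact_UN)
      moreover have "cmod (f x - f y) < \<epsilon>"
        if xy: "(y, x) \<in> E - (\<Union>i\<in>J. K i) \<times> (\<Union>i\<in>J. K i)" for x y
      proof (rule ccontr)
        assume "\<not> cmod (f x - f y) < \<epsilon>"
        moreover have "e x \<in> topspace hX" "e y \<in> topspace hX" using esub by blast+
        ultimately have "(e x, e y) \<in> ?Z" using F(2) by simp
        then obtain i where i: "i \<in> J" "(e x, e y) \<in> ?V i" using J(3) by blast
        obtain g n where gn: "i = (g, n)" by (cases i)
        then have "g \<in> H" using i(1) J(2) by auto
        then have "inverse (real (Suc n)) < cmod (g x - g y)" using i(2) gn by (simp add: e_def)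
        moreover have "cmod (g x - g y) < inverse (real (Suc n))"
        proof -
          have "(y, x) \<in> E - K i \<times> K i" using xy i(1) by blast
          from K(2)[OF i(1) this] show ?thesis by (simp add: gn)
        qed
        ultimately show False by simp
      qed
      ultimately show ?thesis by blast
    qed
    then show "f \<in> H" using f by (simp add: H_def higson_functions_def)
  qed
  have "sublinear_higson_compactification x0 hX e"
    unfolding sublinear_higson_compactification_def compactification_def
    using comp haus emb dense ext H_def by blast
  then show ?thesis by blast
qed

end

theory Submission
  imports Defs
begin

text \<open>The map \<open>\<xi>\<close> sends the class of \<open>(x\<^sub>n)\<close> to the \<open>\<omega>\<close>-limit of \<open>\<iota> x\<^sub>n\<close> in the compact space \<open>h\<^sub>LX\<close>.
  A bounded continuous function \<open>f\<close> is Higson for the sublinear structure iff \<open>f x\<close> and \<open>f y\<close> are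
  close as soon as \<open>dist x y\<close> is small compared with the norm of \<open>x\<close>, and that norm is large. Since the
  norm of \<open>x\<^sub>n\<close> grows linearly in \<open>n\<close> away from the base point, this makes \<open>\<xi>\<close> continuous.

  For injectivity and for continuity of the inverse on an annulus, the class of \<open>(x\<^sub>n)\<close> is singled
  out by the Higson function that is the supremum of bumps of radius proportional to \<open>n\<close> around
  \<open>x\<^sub>n\<close>, where \<open>n\<close> runs through a set in \<open>\<omega>\<close>. As \<open>\<omega>\<close> is exponential, this set can be taken so
  sparse that different scales do not interact on the given annulus.\<close>

section \<open>Ultrafilters: pigeonhole, sparse members, limits in compact spaces\<close>

lemma ultrafilter_eventually_bex:
  assumes F: "ultrafilter F" and I: "finite I" and ev: "eventually (\<lambda>x. \<exists>i\<in>I. P i x) F"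
  shows "\<exists>i\<in>I. eventually (P i) F"
proof (rule ccontr)
  assume "\<not> ?thesis"
  then have "\<forall>i\<in>I. eventually (\<lambda>x. \<not> P i x) F"
    using F by (auto simp: ultrafilter_def)
  then have "eventually (\<lambda>x. \<forall>i\<in>I. \<not> P i x) F"
    using I by (simp add: eventually_ball_finite)
  with ev have "eventually (\<lambda>_. False) F"
    by eventually_elim blast
  then show False using F by (simp add: ultrafilter_def trivial_limit_def)
qed

lemma ultrafilter_not_eventually:
  "ultrafilter F \<Longrightarrow> \<not> eventually P F \<longleftrightarrow> eventually (\<lambda>x. \<not> P x) F"
  unfolding ultrafilter_def using eventually_conj[of P F "\<lambda>x. \<not> P x"]
  by (auto simp: trivial_limit_def)

lemma nonprincipal_le_sequentially:
  assumes "ultrafilter \<omega>" "nonprincipal \<omega>"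
  shows "\<omega> \<le> sequentially"
proof -
  have "eventually (\<lambda>n. n \<ge> N) \<omega>" for N :: nat
  proof (induction N)
    case (Suc N)
    have "eventually (\<lambda>n. \<not> n = N) \<omega>"
      using assms unfolding ultrafilter_def nonprincipal_def by blast
    with Suc show ?case by eventually_elim simp
  qed simp
  then show ?thesis by (auto simp: le_sequentially)
qed

text \<open>Thinning \<open>f\<close> out along a residue class modulo \<open>k\<close> replaces the growth factor \<open>a\<close> by \<open>a ^ k\<close>.\<close>

lemma exponential_ultrafilter_sparse:
  assumes "exponential_ultrafilter \<omega>"
  shows "\<exists>S. eventually (\<lambda>n. n \<in> S) \<omega> \<and> (\<forall>m\<in>S. \<forall>n\<in>S. m < n \<longrightarrow> L * real m \<le> real n)"
proof -
  obtain f a where uf: "ultrafilter \<omega>" and np: "nonprincipal \<omega>" and a: "a > 1"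
    and ev: "\<forall>\<^sub>F n in sequentially. real (f (n + 1)) \<ge> a * real (f n)"
    and rng: "eventually (\<lambda>n. n \<in> range f) \<omega>"
    using assms unfolding exponential_ultrafilter_def by blast
  obtain N where N: "\<And>n. n \<ge> N \<Longrightarrow> real (f (n + 1)) \<ge> a * real (f n)"
    using ev by (auto simp: eventually_sequentially)
  have grow: "real (f (p + j)) \<ge> a ^ j * real (f p)" if "p \<ge> N" for p j
  proof (induction j)
    case (Suc j)
    have "a ^ Suc j * real (f p) \<le> a * real (f (p + j))"
      using Suc a by (simp add: mult.assoc)
    also have "\<dots> \<le> real (f (p + Suc j))"
      using N[of "p + j"] that by simp
    finally show ?case .
  qed simp
  obtain k0 where k0: "L < a ^ k0" using real_arch_pow[OF a] by blast
  define k where "k = Suc k0"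
  have "a ^ k0 \<le> a ^ k" using a by (intro power_increasing) (auto simp: k_def)
  then have k: "L \<le> a ^ k" "k > 0" using k0 by (auto simp: k_def)
  define T where "T j = f ` {n. n \<ge> N \<and> n mod k = j}" for j
  have "eventually (\<lambda>n. n > Max (insert 0 (f ` {..<N}))) sequentially"
    by (rule eventually_gt_at_top)
  then have "eventually (\<lambda>n. n > Max (insert 0 (f ` {..<N}))) \<omega>"
    using nonprincipal_le_sequentially[OF uf np] by (simp add: filter_leD)
  with rng have "eventually (\<lambda>n. \<exists>j\<in>{..<k}. n \<in> T j) \<omega>"
  proof eventually_elim
    case (elim n)
    then obtain p where p: "n = f p" by blast
    have "p \<ge> N"
    proof (rule ccontr)
      assume "\<not> p \<ge> N"
      then have "n \<le> Max (insert 0 (f ` {..<N}))" using p by (intro Max_ge) auto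
      with elim show False by linarith
    qed
    then show ?case using p k(2) by (intro bexI[of _ "p mod k"]) (auto simp: T_def)
  qed
  then obtain j where j: "eventually (\<lambda>n. n \<in> T j) \<omega>"
    using ultrafilter_eventually_bex[OF uf finite_lessThan, where P="\<lambda>j n. n \<in> T j"] by blast
  have "L * real m \<le> real n" if mn: "m \<in> T j" "n \<in> T j" "m < n" for m n
  proof -
    obtain p q where p: "m = f p" "p \<ge> N" "p mod k = j" and q: "n = f q" "q \<ge> N" "q mod k = j"
      using mn unfolding T_def by blast
    \<comment> \<open>From \<open>N\<close> on the values of \<open>f\<close> do not decrease, so
      the order of values gives the order of indices; congruent indices then differ by at least
      \<open>k\<close>.\<close>
    have "p < q"
    proof (rule ccontr)
      assume "\<not> p < q"
      then have "a ^ (p - q) * real (f q) \<le> real (f p)"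
        using grow[of q "p - q"] q by simp
      moreover have "1 * real (f q) \<le> a ^ (p - q) * real (f q)"
        using a by (intro mult_right_mono) auto
      ultimately show False using mn(3) p q by simp
    qed
    then have "k dvd q - p" using p q by (metis mod_eq_dvd_iff_nat less_imp_le)
    then have "k \<le> q - p" using \<open>p < q\<close> by (simp add: dvd_imp_le)
    then have "L \<le> a ^ (q - p)"
      using k(1) a power_increasing[of k "q - p" a] by linarith
    then have "L * real m \<le> a ^ (q - p) * real m" by (rule mult_right_mono) simp
    also have "\<dots> \<le> real n" using grow[of p "q - p"] p q \<open>p < q\<close> by simp
    finally show ?thesis .
  qed
  with j show ?thesis by blast
qed

text \<open>If no point is a limit, the ultrafilter dichotomy gives each point a neighbourhood that
  the family eventually avoids. Finitely many of these cover the space, and avoiding all of them at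
  once is impossible.\<close>

lemma ultrafilter_limitin_compact_space:
  assumes F: "ultrafilter F" and X: "compact_space X" and f: "\<And>i. f i \<in> topspace X"
  shows "\<exists>p. limitin X f p F"
proof (rule ccontr)
  assume no: "\<not> ?thesis"
  have "\<exists>U. openin X U \<and> p \<in> U \<and> eventually (\<lambda>i. f i \<notin> U) F" if "p \<in> topspace X" for p
    using no that F unfolding limitin_def by (metis ultrafilter_not_eventually)
  then obtain U where U: "\<And>p. p \<in> topspace X \<Longrightarrow> openin X (U p)"
    "\<And>p. p \<in> topspace X \<Longrightarrow> p \<in> U p"
    "\<And>p. p \<in> topspace X \<Longrightarrow> eventually (\<lambda>i. f i \<notin> U p) F"
    by metis
  have "compactin X (topspace X)" using X by (simp add: compact_space_def)
  moreover have "\<And>V. V \<in> U ` topspace X \<Longrightarrow> openin X V" using U(1) by blast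
  moreover have "topspace X \<subseteq> \<Union> (U ` topspace X)" using U(2) by blast
  ultimately obtain \<F> where fin: "finite \<F>" and sub: "\<F> \<subseteq> U ` topspace X"
    and cov: "topspace X \<subseteq> \<Union> \<F>"
    by (meson compactinD)
  have "\<forall>V\<in>\<F>. eventually (\<lambda>i. f i \<notin> V) F" using sub U(3) by blast
  then have "eventually (\<lambda>i. \<forall>V\<in>\<F>. f i \<notin> V) F" using fin by (simp add: eventually_ball_finite)
  moreover have "\<not> (\<forall>V\<in>\<F>. f i \<notin> V)" for i using f[of i] cov by blast
  ultimately have "eventually (\<lambda>_. False) F" by simp
  then show False using F by (simp add: ultrafilter_def trivial_limit_def)
qed

section \<open>A metric characterization of Higson functions\<close>

lemma converse_range_Pair: "(range (\<lambda>k. (u k, v k)))\<inverse> = range (\<lambda>k. (v k, u k))"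
  by auto

lemma entourage_image_range_Pair: "entourage_image (range (\<lambda>k. (u k, v k))) K = u ` {k. v k \<in> K}"
  by (auto simp: entourage_image_def)

text \<open>A bounded set contains \<open>v k\<close> for finitely many \<open>k\<close> only, so
  the image is finite. Applied to both orders of the pairs, this makes a test sequence a proper
  entourage.\<close>

lemma compact_closure_entourage_image_sequence:
  fixes u v :: "nat \<Rightarrow> 'a::metric_space"
  assumes v: "\<And>k. real k \<le> dist (v k) x0" and K: "compact (closure K)"
  shows "compact (closure (entourage_image (range (\<lambda>k. (u k, v k))) K))"
proof -
  have "bounded K"
    using K closure_subset bounded_subset compact_imp_bounded by metis
  then obtain B where B: "\<And>x. x \<in> K \<Longrightarrow> dist x x0 \<le> B"
    unfolding bounded_any_center[of K x0] by (auto simp: dist_commute)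
  have "k \<le> nat \<lfloor>B\<rfloor>" if "v k \<in> K" for k
    using v[of k] B[OF that] by (meson le_nat_floor order_trans)
  then have "{k. v k \<in> K} \<subseteq> {..nat \<lfloor>B\<rfloor>}" by blast
  then have "finite (u ` {k. v k \<in> K})" by (meson finite_atMost finite_imageI finite_subset)
  then show ?thesis
    by (simp add: entourage_image_range_Pair finite_imp_closed finite_imp_compact)
qed

lemma sup_dist_sequence_tendsto:
  fixes u v :: "nat \<Rightarrow> 'a::metric_space"
  assumes d: "\<And>k. dist (u k) (v k) \<le> w k * dist (v k) x0" and w: "w \<longlonglongrightarrow> 0"
  shows "((\<lambda>x. sup_dist (entourage_image (range (\<lambda>k. (u k, v k))) {x}) x / dist x x0) \<longlongrightarrow> 0)
           (filtercomap (\<lambda>x. dist x x0) at_top)"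
proof (rule tendstoI)
  fix e :: real assume e: "e > 0"
  obtain N where N: "\<And>k. k \<ge> N \<Longrightarrow> w k < e / 2"
    using order_tendstoD(2)[OF w, of "e / 2"] e by (auto simp: eventually_sequentially)
  \<comment> \<open>Beyond norm \<open>R\<close> only indices \<open>k \<ge> N\<close> can have
    \<open>v k = x\<close>. The inserted 0 covers \<open>N = 0\<close> and gives
    \<open>R \<ge> 0\<close>, so that \<open>x\<close> has positive norm.\<close>
  define R where "R = Max (insert 0 ((\<lambda>k. dist (v k) x0) ` {..<N}))"
  have "eventually (\<lambda>x. dist x x0 > R) (filtercomap (\<lambda>x. dist x x0) at_top)"
    using eventually_filtercomapI[OF eventually_gt_at_top[of R]] .
  then show "\<forall>\<^sub>F x in filtercomap (\<lambda>x. dist x x0) at_top.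
    dist (sup_dist (entourage_image (range (\<lambda>k. (u k, v k))) {x}) x / dist x x0) 0 < e"
  proof eventually_elim
    case (elim x)
    let ?S = "u ` {k. v k \<in> {x}}"
    have "R \<ge> 0" unfolding R_def by (intro Max_ge) auto
    then have pos: "dist x x0 > 0" using elim by linarith
    have bd: "dist y x \<le> e / 2 * dist x x0" if y: "y \<in> ?S" for y
    proof -
      obtain k where k: "y = u k" "v k = x" using y by blast
      have "k \<ge> N"
      proof (rule ccontr)
        assume "\<not> k \<ge> N"
        then have "dist (v k) x0 \<le> R" unfolding R_def by (intro Max_ge) auto
        then show False using elim k by simp
      qed
      then have "w k * dist x x0 \<le> e / 2 * dist x x0"
        using N by (intro mult_right_mono) (auto intro: less_imp_le)
      then show ?thesis using d[of k] k by simp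
    qed
    have "0 \<le> sup_dist ?S x \<and> sup_dist ?S x \<le> e / 2 * dist x x0"
    proof (cases "?S = {}")
      case True
      then show ?thesis using e by (simp add: sup_dist_def)
    next
      case False
      then obtain y where y: "y \<in> ?S" by blast
      have "0 \<le> (SUP y\<in>?S. dist y x)"
        using bdd_aboveI2[of ?S "\<lambda>y. dist y x", OF bd] y by (rule cSUP_upper2) simp_all
      moreover have "(SUP y\<in>?S. dist y x) \<le> e / 2 * dist x x0"
        using False bd by (rule cSUP_least)
      ultimately show ?thesis using False by (simp add: sup_dist_def)
    qed
    moreover have "e / 2 * dist x x0 < e * dist x x0" using e pos by simp
    ultimately have "0 \<le> sup_dist ?S x" "sup_dist ?S x < e * dist x x0" by linarith+
    then show ?case
      using pos by (simp add: entourage_image_range_Pair divide_less_eq)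
  qed
qed

text \<open>The necessity of the last condition is seen by testing on the entourage formed by a sequence
  of pairs that violate it.\<close>

lemma higson_functions_iff:
  fixes f :: "'a::metric_space \<Rightarrow> complex" and x0 :: 'a
  assumes proper: "\<forall>S :: 'a set. closed S \<and> bounded S \<longrightarrow> compact S"
  shows "f \<in> higson_functions x0 \<longleftrightarrow> continuous_on UNIV f \<and> bounded (range f) \<and>
    (\<forall>\<epsilon>>0. \<exists>\<delta>>0. \<exists>R. \<forall>x y. R \<le> dist x x0 \<and> dist x y \<le> \<delta> * dist x x0 \<longrightarrow> cmod (f x - f y) < \<epsilon>)"
    (is "_ \<longleftrightarrow> _ \<and> _ \<and> ?slow")
proof
  assume f: "f \<in> higson_functions x0"
  have ?slow
  proof (rule ccontr)
    assume "\<not> ?slow"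
    then obtain \<epsilon> where \<epsilon>: "\<epsilon> > 0" and bad: "\<And>\<delta> R. \<delta> > 0 \<Longrightarrow>
        \<exists>x y. R \<le> dist x x0 \<and> dist x y \<le> \<delta> * dist x x0 \<and> \<not> cmod (f x - f y) < \<epsilon>"
      by blast
    \<comment> \<open>The factor \<open>1 / real (k + 2)\<close> is at most 1/2, so
      \<open>y k\<close> keeps at least half the norm of \<open>x k\<close>. Starting from norm
      \<open>2 * real k\<close>, both components have norm at least \<open>k\<close>, which makes
      the pairs a proper entourage.\<close>
    have "\<exists>x y. 2 * real k \<le> dist x x0 \<and> dist x y \<le> 1 / real (k + 2) * dist x x0 \<and>
        \<not> cmod (f x - f y) < \<epsilon>" for k
      by (rule bad) simp
    then obtain x y where x: "\<And>k. 2 * real k \<le> dist (x k) x0"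
      and xy: "\<And>k. dist (x k) (y k) \<le> 1 / real (k + 2) * dist (x k) x0"
      and far: "\<And>k. \<not> cmod (f (x k) - f (y k)) < \<epsilon>"
      by metis
    have half: "dist (x k) x0 \<le> 2 * dist (y k) x0" for k
    proof -
      have "1 / real (k + 2) * dist (x k) x0 \<le> 1 / 2 * dist (x k) x0"
        by (intro mult_right_mono) (auto simp: field_simps)
      then show ?thesis
        using xy[of k] dist_triangle[of "x k" x0 "y k"] by linarith
    qed
    let ?E = "range (\<lambda>k. (y k, x k))"
    have lim: "(\<lambda>k. c / real (k + 2)) \<longlonglongrightarrow> 0" for c
      using LIMSEQ_ignore_initial_segment[OF lim_const_over_n[of c], of 2] by simp
    have "?E \<in> sublinear_coarse x0"
      unfolding sublinear_coarse_def proper_entourage_def mem_Collect_eq converse_range_Pair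
    proof (intro conjI allI impI)
      fix K :: "'a set" assume K: "compact (closure K)"
      have "real k \<le> dist (x k) x0" "real k \<le> dist (y k) x0" for k
        using x[of k] half[of k] by simp_all
      then show "compact (closure (entourage_image ?E K))"
        "compact (closure (entourage_image (range (\<lambda>k. (x k, y k))) K))"
        using K by (auto intro: compact_closure_entourage_image_sequence)
    next
      show "((\<lambda>z. sup_dist (entourage_image ?E {z}) z / dist z x0) \<longlongrightarrow> 0)
           (filtercomap (\<lambda>z. dist z x0) at_top)"
        by (rule sup_dist_sequence_tendsto[OF _ lim[of 1]]) (metis xy dist_commute)
      have "dist (x k) (y k) \<le> 2 / real (k + 2) * dist (y k) x0" for k
      proof -
        have "1 / real (k + 2) * dist (x k) x0 \<le> 1 / real (k + 2) * (2 * dist (y k) x0)"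
          using half by (intro mult_left_mono) auto
        then show ?thesis using xy[of k] by (simp add: mult.commute)
      qed
      then show "((\<lambda>z. sup_dist (entourage_image (range (\<lambda>k. (x k, y k))) {z}) z / dist z x0)
           \<longlongrightarrow> 0) (filtercomap (\<lambda>z. dist z x0) at_top)"
        by (rule sup_dist_sequence_tendsto[OF _ lim[of 2]])
    qed
    then obtain K where K: "compact K"
      "\<And>x y. (y, x) \<in> ?E - K \<times> K \<Longrightarrow> cmod (f x - f y) < \<epsilon>"
      using f \<epsilon> unfolding higson_functions_def by blast
    \<comment> \<open>Each bad pair must lie in \<open>K \<times> K\<close>, so the unbounded
      sequence \<open>x\<close> would stay in a compact set.\<close>
    then have "x k \<in> K" for k
      using far[of k] by blast
    moreover obtain B where "\<And>z. z \<in> K \<Longrightarrow> dist x0 z \<le> B"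
      using compact_imp_bounded[OF K(1)] unfolding bounded_any_center[of K x0] by blast
    ultimately have "dist (x k) x0 \<le> B" for k
      by (metis dist_commute)
    then have "2 * real k \<le> B" for k using x[of k] order_trans by blast
    moreover obtain k where "real k > B" using reals_Archimedean2 by blast
    moreover have "2 * real k \<ge> real k" by simp
    ultimately show False by (meson leD order_trans)
  qed
  with f show "continuous_on UNIV f \<and> bounded (range f) \<and> ?slow"
    by (simp add: higson_functions_def)
next
  assume f: "continuous_on UNIV f \<and> bounded (range f) \<and> ?slow"
  have "\<exists>K. compact K \<and> (\<forall>x y. (y, x) \<in> E - K \<times> K \<longrightarrow> cmod (f x - f y) < \<epsilon>)"
    if E: "E \<in> sublinear_coarse x0" and \<epsilon>: "\<epsilon> > 0" for E \<epsilon>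
  proof -
    obtain \<delta> R where \<delta>: "\<delta> > 0" and slow: "\<And>x y. R \<le> dist x x0 \<Longrightarrow>
        dist x y \<le> \<delta> * dist x x0 \<Longrightarrow> cmod (f x - f y) < \<epsilon>"
      using f \<epsilon> by blast
    have pe: "proper_entourage E"
      and lim: "((\<lambda>x. sup_dist (entourage_image E {x}) x / dist x x0) \<longlongrightarrow> 0)
        (filtercomap (\<lambda>x. dist x x0) at_top)"
      using E by (auto simp: sublinear_coarse_def)
    obtain R' where R': "\<And>x. dist x x0 \<ge> R' \<Longrightarrow>
        sup_dist (entourage_image E {x}) x / dist x x0 < \<delta>"
      using order_tendstoD(2)[OF lim \<delta>]
      by (auto simp: eventually_filtercomap eventually_at_top_linorder)
    \<comment> \<open>Outside \<open>B\<close> both thresholds are passed and the norm is positive.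
      Adding the closure of the image of \<open>B\<close> to \<open>?K\<close> ensures that a pair
      of \<open>E\<close> outside \<open>?K \<times> ?K\<close> has \<open>x\<close> outside
      \<open>B\<close>.\<close>
    define B where "B = cball x0 (max 0 (max R R'))"
    let ?K = "B \<union> closure (entourage_image E B)"
    have "compact B" using proper by (simp add: B_def)
    then have "compact ?K"
      using pe by (auto simp: proper_entourage_def compact_imp_closed intro!: compact_Un)
    moreover have "cmod (f x - f y) < \<epsilon>" if yx: "(y, x) \<in> E - ?K \<times> ?K" for x y
    proof -
      have "x \<notin> B"
      proof
        assume "x \<in> B"
        then have "y \<in> entourage_image E B" using yx by (auto simp: entourage_image_def)
        then have "y \<in> ?K" using closure_subset by blast
        with \<open>x \<in> B\<close> yx show False by blast
      qed
      then have far: "dist x x0 \<ge> R" "dist x x0 \<ge> R'" "dist x x0 > 0"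
        by (auto simp: B_def dist_commute)
      have y: "y \<in> entourage_image E {x}" using yx by (auto simp: entourage_image_def)
      \<comment> \<open>Relative compactness bounds the section, so that \<open>sup_dist\<close>
        really dominates its distances.\<close>
      have "compact (closure (entourage_image E {x}))"
        using pe by (simp add: proper_entourage_def)
      then have "bounded (entourage_image E {x})"
        using closure_subset bounded_subset compact_imp_bounded by metis
      then obtain M where "\<And>z. z \<in> entourage_image E {x} \<Longrightarrow> dist x z \<le> M"
        unfolding bounded_any_center[of _ x] by blast
      then have "bdd_above ((\<lambda>z. dist z x) ` entourage_image E {x})"
        by (intro bdd_aboveI2[where M=M]) (simp add: dist_commute)
      then have "dist y x \<le> sup_dist (entourage_image E {x}) x"
        using y by (auto simp: sup_dist_def intro: cSUP_upper)
      also have "\<dots> \<le> \<delta> * dist x x0"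
        using R'[OF far(2)] far(3) by (simp add: divide_less_eq)
      finally show ?thesis using slow far(1) by (simp add: dist_commute)
    qed
    ultimately show ?thesis by blast
  qed
  then show "f \<in> higson_functions x0" using f by (simp add: higson_functions_def)
qed

section \<open>Suprema of bumps at growing scales\<close>

lemma cSUP_abs_diff_le:
  fixes f g :: "'i \<Rightarrow> real"
  assumes S: "S \<noteq> {}" and f: "bdd_above (f ` S)" and g: "bdd_above (g ` S)"
    and t: "\<And>n. n \<in> S \<Longrightarrow> \<bar>f n - g n\<bar> \<le> t"
  shows "\<bar>(SUP n\<in>S. f n) - (SUP n\<in>S. g n)\<bar> \<le> t"
proof -
  have "(SUP n\<in>S. f n) \<le> (SUP n\<in>S. g n) + t"
  proof (rule cSUP_least[OF S])
    fix n assume n: "n \<in> S"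
    show "f n \<le> (SUP n\<in>S. g n) + t" using t[OF n] cSUP_upper[OF n g] by linarith
  qed
  moreover have "(SUP n\<in>S. g n) \<le> (SUP n\<in>S. f n) + t"
  proof (rule cSUP_least[OF S])
    fix n assume n: "n \<in> S"
    show "g n \<le> (SUP n\<in>S. f n) + t" using t[OF n] cSUP_upper[OF n f] by linarith
  qed
  ultimately show ?thesis by linarith
qed

text \<open>Tents rather than indicators give Lipschitz functions; the radius proportional to
  \<open>n\<close> makes the slope at scale \<open>n\<close> decay like \<open>1 / n\<close>, as
  slow variation requires.\<close>

definition scaled_bumps :: "nat set \<Rightarrow> (nat \<Rightarrow> 'a::metric_space) \<Rightarrow> real \<Rightarrow> 'a \<Rightarrow> real" where
  "scaled_bumps S z e x = (SUP n\<in>S. max 0 (1 - dist x (z n) / (e * real n)))"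

lemma bdd_above_scaled_bumps:
  "e > 0 \<Longrightarrow> bdd_above ((\<lambda>n. max 0 (1 - dist x (z n) / (e * real n))) ` S)"
  by (rule bdd_aboveI2[where M=1]) simp

lemma scaled_bumps_center:
  assumes "e > 0" "n \<in> S"
  shows "scaled_bumps S z e (z n) = 1"
proof (rule antisym)
  show "scaled_bumps S z e (z n) \<le> 1"
    unfolding scaled_bumps_def using assms by (intro cSUP_least) auto
  show "1 \<le> scaled_bumps S z e (z n)"
    unfolding scaled_bumps_def
    by (rule cSUP_upper2[OF bdd_above_scaled_bumps[OF assms(1)] assms(2)]) simp
qed

lemma scaled_bumps_eq_0:
  assumes "e > 0" "S \<noteq> {}" "\<And>m. m \<in> S \<Longrightarrow> m \<ge> 1" "\<And>m. m \<in> S \<Longrightarrow> e * real m \<le> dist x (z m)"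
  shows "scaled_bumps S z e x = 0"
proof -
  have "max 0 (1 - dist x (z m) / (e * real m)) = 0" if "m \<in> S" for m
  proof -
    \<comment> \<open>Positivity of \<open>m\<close> matters: division by 0 yields 0, so at
      \<open>m = 0\<close> the bump would be constantly 1.\<close>
    have "e * real m > 0" using assms(1) assms(3)[OF that] by simp
    then show ?thesis using assms(4)[OF that] by (simp add: le_divide_eq)
  qed
  then have "scaled_bumps S z e x = (SUP m\<in>S. 0)"
    unfolding scaled_bumps_def by (intro SUP_cong) auto
  then show ?thesis using assms(2) by simp
qed

lemma bump_diff_le:
  fixes x y z :: "'a::metric_space"
  assumes "s > 0"
  shows "\<bar>max 0 (1 - dist x z / s) - max 0 (1 - dist y z / s)\<bar> \<le> dist x y / s"
proof -
  have "dist x z / s \<le> dist x y / s + dist y z / s" "dist y z / s \<le> dist x y / s + dist x z / s"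
    using assms dist_triangle[of x z y] dist_triangle3[of y z x]
    by (simp_all flip: add_divide_distrib add: divide_right_mono dist_commute)
  moreover have "0 \<le> dist x y / s" using assms by simp
  ultimately show ?thesis by (auto simp: max_def abs_if)
qed

text \<open>A bump that is nonzero at \<open>x\<close> or at a point near \<open>x\<close> has a centre \<open>z n\<close> with
  \<open>n\<close> at least proportional to \<open>dist x x0\<close>, so its slope is of order \<open>1 / dist x x0\<close>.\<close>

lemma scaled_bumps_higson:
  fixes x0 :: "'a::metric_space"
  assumes proper: "\<forall>S :: 'a set. closed S \<and> bounded S \<longrightarrow> compact S"
    and S: "S \<noteq> {}" and pos: "\<And>n. n \<in> S \<Longrightarrow> n \<ge> 1"
    and z: "\<And>n. n \<in> S \<Longrightarrow> dist (z n) x0 \<le> C * real n" and e: "e > 0"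
  shows "(\<lambda>x. complex_of_real (scaled_bumps S z e x)) \<in> higson_functions x0"
proof -
  define h where "h n x = max 0 (1 - dist x (z n) / (e * real n))" for n x
  have g: "scaled_bumps S z e x = (SUP n\<in>S. h n x)" for x
    by (simp add: scaled_bumps_def h_def)
  have bdd: "bdd_above ((\<lambda>n. h n x) ` S)" for x
    unfolding h_def by (rule bdd_above_scaled_bumps[OF e])
  have hd: "\<bar>h n x - h n y\<bar> \<le> dist x y / (e * real n)" if "n \<in> S" for n x y
    unfolding h_def using pos[OF that] e by (intro bump_diff_le) simp
  obtain n0 where n0: "n0 \<in> S" using S by blast
  have "0 \<le> C * real n0" using z[OF n0] order_trans[OF zero_le_dist] by blast
  then have C: "C \<ge> 0" using pos[OF n0] by (simp add: zero_le_mult_iff)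
  have lip: "\<bar>scaled_bumps S z e x - scaled_bumps S z e y\<bar> \<le> dist x y / e" for x y
    unfolding g
  proof (rule cSUP_abs_diff_le[OF S bdd bdd])
    fix n assume n: "n \<in> S"
    have "dist x y / (e * real n) \<le> dist x y / e"
      using pos[OF n] e by (intro divide_left_mono) auto
    then show "\<bar>h n x - h n y\<bar> \<le> dist x y / e" using hd[OF n, of x y] by linarith
  qed
  have cont: "continuous_on UNIV (scaled_bumps S z e)"
    unfolding continuous_on_iff
  proof (intro ballI allI impI)
    fix x and \<epsilon> :: real assume \<epsilon>: "\<epsilon> > 0"
    have "dist (scaled_bumps S z e y) (scaled_bumps S z e x) < \<epsilon>" if "dist y x < \<epsilon> * e" for y
    proof -
      have "dist y x / e < \<epsilon>" using that e by (simp add: divide_less_eq)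
      then show ?thesis using lip[of y x] by (simp add: dist_real_def)
    qed
    then show "\<exists>d>0. \<forall>y\<in>UNIV. dist y x < d \<longrightarrow>
        dist (scaled_bumps S z e y) (scaled_bumps S z e x) < \<epsilon>"
      using \<epsilon> e by (intro exI[of _ "\<epsilon> * e"]) simp
  qed
  have "0 \<le> scaled_bumps S z e x \<and> scaled_bumps S z e x \<le> 1" for x
  proof
    show "0 \<le> scaled_bumps S z e x"
      unfolding g by (rule cSUP_upper2[OF bdd n0]) (simp add: h_def)
    show "scaled_bumps S z e x \<le> 1"
      unfolding g by (rule cSUP_least[OF S]) (use e in \<open>simp add: h_def\<close>)
  qed
  then have bounded: "bounded (range (\<lambda>x. complex_of_real (scaled_bumps S z e x)))"
    by (intro boundedI[where B=1]) auto
  have "\<exists>\<delta>>0. \<exists>R. \<forall>x y. R \<le> dist x x0 \<and> dist x y \<le> \<delta> * dist x x0 \<longrightarrow>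
      cmod (complex_of_real (scaled_bumps S z e x) - complex_of_real (scaled_bumps S z e y)) < \<epsilon>"
    if \<epsilon>: "\<epsilon> > 0" for \<epsilon>
  proof -
    \<comment> \<open>The bound 1/2 makes the norms of \<open>x\<close> and \<open>y\<close>
      comparable. The other term turns the bound \<open>2 * ((C + e) * real n)\<close> on the norm
      of \<open>x\<close> into \<open>\<epsilon> / 2\<close> times the radius
      \<open>e * real n\<close>; the half leaves room for a strict inequality.\<close>
    define \<delta> where "\<delta> = min (1 / 2) (\<epsilon> * e / (4 * (C + e)))"
    have \<delta>: "\<delta> > 0" "\<delta> \<le> 1 / 2" "\<delta> \<le> \<epsilon> * e / (4 * (C + e))"
      using \<epsilon> e C unfolding \<delta>_def by (simp_all only: min.cobounded1 min.cobounded2) simp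
    have "\<bar>scaled_bumps S z e x - scaled_bumps S z e y\<bar> \<le> \<epsilon> / 2"
      if x: "dist x x0 \<ge> 1" and xy: "dist x y \<le> \<delta> * dist x x0" for x y
      unfolding g
    proof (rule cSUP_abs_diff_le[OF S bdd bdd])
      fix n assume n: "n \<in> S"
      have en: "e * real n > 0" using e pos[OF n] by simp
      show "\<bar>h n x - h n y\<bar> \<le> \<epsilon> / 2"
      proof (cases "h n x = 0 \<and> h n y = 0")
        case True
        then show ?thesis using \<epsilon> by simp
      next
        case False
        then obtain w where w: "w = x \<or> w = y" "h n w \<noteq> 0" by blast
        have "dist w (z n) < e * real n"
          using w(2) en unfolding h_def by (auto simp: max_def divide_less_eq le_divide_eq split: if_splits)
        then have "dist w x0 \<le> (C + e) * real n"
          using z[OF n] dist_triangle[of w x0 "z n"] by (simp add: distrib_right)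
        moreover have "\<delta> * dist x x0 \<le> 1 / 2 * dist x x0"
          using \<delta> by (intro mult_right_mono) auto
        then have "dist x x0 \<le> 2 * dist w x0"
          using w(1) xy dist_triangle[of x x0 y] by auto
        ultimately have xn: "dist x x0 \<le> 2 * ((C + e) * real n)" by linarith
        have "dist x y \<le> \<delta> * (2 * ((C + e) * real n))"
          using xy mult_left_mono[OF xn, of \<delta>] \<delta>(1) by linarith
        also have "\<dots> \<le> \<epsilon> * e / (4 * (C + e)) * (2 * ((C + e) * real n))"
          using \<delta>(3) C e by (intro mult_right_mono) auto
        also have "\<dots> = \<epsilon> / 2 * (e * real n)"
        proof -
          have "C + e \<noteq> 0" using C e by linarith
          then show ?thesis by (simp add: field_simps)
        qed
        finally have "dist x y / (e * real n) \<le> \<epsilon> / 2"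
          using en by (simp add: divide_le_eq)
        then show ?thesis using hd[OF n, of x y] by linarith
      qed
    qed
    then have "cmod (complex_of_real (scaled_bumps S z e x) - complex_of_real (scaled_bumps S z e y)) < \<epsilon>"
      if "1 \<le> dist x x0" "dist x y \<le> \<delta> * dist x x0" for x y
      using that \<epsilon> by (force simp flip: of_real_diff)
    then show ?thesis using \<delta>(1) by blast
  qed
  then show ?thesis
    unfolding higson_functions_iff[OF proper]
    using cont bounded by (auto intro: continuous_on_of_real)
qed

section \<open>The limit map and the norm in the cone\<close>

text \<open>The choice of representative is the one made in \<open>cone_dist\<close>, so that cone
  distances and limit points are read off the same sequences.\<close>

definition cone_limit_point ::
    "nat filter \<Rightarrow> 'b topology \<Rightarrow> ('a \<Rightarrow> 'b) \<Rightarrow> (nat \<Rightarrow> 'a) set \<Rightarrow> 'b" where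
  "cone_limit_point \<omega> hX \<iota> A = (SOME p. limitin hX (\<lambda>n. \<iota> ((SOME x. x \<in> A) n)) p \<omega>)"

context
  fixes \<omega> :: "nat filter" and x0 :: "'a::metric_space"
  assumes uf: "ultrafilter \<omega>" and np: "nonprincipal \<omega>"
begin

lemma cone_representative:
  assumes "A \<in> asymp_cone \<omega> x0"
  shows "(SOME x. x \<in> A) \<in> cone_seqs x0" "cone_class \<omega> x0 (SOME x. x \<in> A) = A"
proof -
  obtain x where x: "x \<in> cone_seqs x0" "A = cone_class \<omega> x0 x"
    using asymp_coneE[OF uf np assms] .
  have "x \<in> A"
    using equiv_class_self[OF cone_rel_equiv[OF uf np] x(1)] x(2) by (simp add: cone_class_def)
  then have "(SOME x. x \<in> A) \<in> A" by (rule someI[where P="\<lambda>u. u \<in> A"])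
  then have rel: "(x, SOME x. x \<in> A) \<in> cone_rel \<omega> x0" using x(2) by (simp add: cone_class_def)
  then show "(SOME x. x \<in> A) \<in> cone_seqs x0" by (simp add: cone_rel_def)
  show "cone_class \<omega> x0 (SOME x. x \<in> A) = A"
    using equiv_class_eq[OF cone_rel_equiv[OF uf np] rel] x(2) unfolding cone_class_def by metis
qed

lemma cone_dist_tendsto:
  assumes "A \<in> asymp_cone \<omega> x0" "B \<in> asymp_cone \<omega> x0"
  shows "((\<lambda>n. dist ((SOME x. x \<in> A) n) ((SOME x. x \<in> B) n) / real n)
           \<longlongrightarrow> cone_dist \<omega> x0 A B) \<omega>"
  using cone_limit[OF uf np cone_representative(1)[OF assms(1)] cone_representative(1)[OF assms(2)]]
  by (simp add: cone_dist_def assms)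

lemma cone_base_in: "cone_base \<omega> x0 \<in> asymp_cone \<omega> x0"
  unfolding cone_base_def by (intro cone_class_in[OF uf np] const_cone_seqs)

text \<open>The representative chosen for the base class need not be constant; independence of
  representatives, \<open>cone_dist_class\<close>, lets \<open>x0\<close> replace it.\<close>

lemma cone_dist_base_tendsto:
  assumes "A \<in> asymp_cone \<omega> x0"
  shows "((\<lambda>n. dist ((SOME x. x \<in> A) n) x0 / real n)
           \<longlongrightarrow> cone_dist \<omega> x0 A (cone_base \<omega> x0)) \<omega>"
  using cone_limit[OF uf np cone_representative(1)[OF assms] const_cone_seqs]
    cone_dist_class[OF uf np cone_representative(1)[OF assms] const_cone_seqs]
  by (simp add: cone_base_def cone_representative(2)[OF assms])

lemma cone_dist_base_pos:
  assumes "A \<in> asymp_cone \<omega> x0" "A \<noteq> cone_base \<omega> x0"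
  shows "cone_dist \<omega> x0 A (cone_base \<omega> x0) > 0"
  using Metric_space.mdist_pos_less[OF Metric_space_cone[OF uf np]] assms cone_base_in by blast

text \<open>Off the base point the norm along the representative eventually exceeds half the
  positive cone norm times \<open>n\<close>, and \<open>n\<close> tends to infinity along
  \<open>\<omega>\<close>.\<close>

lemma eventually_representative_far:
  assumes A: "A \<in> asymp_cone \<omega> x0" "A \<noteq> cone_base \<omega> x0"
  shows "eventually (\<lambda>n. R \<le> dist ((SOME x. x \<in> A) n) x0) \<omega>"
proof -
  let ?c = "cone_dist \<omega> x0 A (cone_base \<omega> x0)"
  have c: "?c > 0" by (rule cone_dist_base_pos[OF A])
  obtain N :: nat where N: "R / (?c / 2) \<le> real N" using real_arch_simple by blast
  have "eventually (\<lambda>n. n \<ge> max 1 N) \<omega>"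
    using nonprincipal_le_sequentially[OF uf np] unfolding le_sequentially by blast
  moreover have "eventually (\<lambda>n. ?c / 2 < dist ((SOME x. x \<in> A) n) x0 / real n) \<omega>"
    using c by (intro order_tendstoD(1)[OF cone_dist_base_tendsto[OF A(1)]]) simp
  ultimately show ?thesis
  proof eventually_elim
    case (elim n)
    have "R \<le> ?c / 2 * real N" using N c by (simp add: field_simps)
    also have "\<dots> \<le> ?c / 2 * real n" using elim c by (intro mult_left_mono) auto
    also have "\<dots> \<le> dist ((SOME x. x \<in> A) n) x0"
      using elim by (simp add: less_divide_eq)
    finally show ?case .
  qed
qed

section \<open>Limit points in the corona: continuity, and separation on annuli\<close>

context
  fixes hX :: "'b topology" and \<iota> :: "'a \<Rightarrow> 'b"
  assumes proper: "\<forall>S :: 'a set. closed S \<and> bounded S \<longrightarrow> compact S"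
    and hc: "sublinear_higson_compactification x0 hX \<iota>"
begin

lemma compactification_hX: "compact_space hX" "Hausdorff_space hX" "continuous_map euclidean hX \<iota>"
proof -
  have comp: "compactification hX \<iota>"
    using hc by (simp add: sublinear_higson_compactification_def)
  then show "compact_space hX" "Hausdorff_space hX" by (simp_all add: compactification_def)
  from comp have "homeomorphic_map euclidean (subtopology hX (\<iota> ` topspace euclidean)) \<iota>"
    by (simp add: compactification_def embedding_map_def)
  then show "continuous_map euclidean hX \<iota>"
    using homeomorphic_imp_continuous_map continuous_map_into_fulltopology by blast
qed

lemma iota_in: "\<iota> x \<in> topspace hX"
  using compactification_hX(3) by (auto simp: continuous_map_def)

lemma continuous_restriction_higson:
  assumes F: "continuous_map hX euclidean F"
  shows "(\<lambda>x. F (\<iota> x)) \<in> higson_functions x0"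
proof -
  have "continuous_map euclidean euclidean (F \<circ> \<iota>)"
    by (rule continuous_map_compose[OF compactification_hX(3) F])
  then have "continuous_on UNIV (\<lambda>x. F (\<iota> x))" by (simp add: o_def)
  moreover have "compactin euclidean (F ` topspace hX)"
    using image_compactin[OF _ F] compactification_hX(1) by (simp add: compact_space_def)
  then have "bounded (F ` topspace hX)" by (simp add: compact_imp_bounded)
  then have "bounded (range (\<lambda>x. F (\<iota> x)))"
    by (rule bounded_subset) (use iota_in in blast)
  ultimately show ?thesis
    using hc F unfolding sublinear_higson_compactification_def by blast
qed

lemma higson_extension:
  assumes "f \<in> higson_functions x0"
  obtains F where "continuous_map hX euclidean F" "\<And>x. F (\<iota> x) = f x"
proof -
  have "continuous_on UNIV f" "bounded (range f)"
    using assms by (simp_all add: higson_functions_def)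
  then show thesis
    using hc assms that unfolding sublinear_higson_compactification_def by blast
qed

lemma limitin_cone_limit_point:
  "limitin hX (\<lambda>n. \<iota> ((SOME x. x \<in> A) n)) (cone_limit_point \<omega> hX \<iota> A) \<omega>"
  unfolding cone_limit_point_def
  by (rule someI_ex, rule ultrafilter_limitin_compact_space[OF uf compactification_hX(1) iota_in])

lemma tendsto_cone_limit_point:
  assumes "continuous_map hX euclidean F"
  shows "((\<lambda>n. F (\<iota> ((SOME x. x \<in> A) n))) \<longlongrightarrow> F (cone_limit_point \<omega> hX \<iota> A)) \<omega>"
  using continuous_map_limit[OF assms limitin_cone_limit_point[of A]] by (simp add: o_def)

text \<open>A bump around \<open>p\<close> extends to \<open>hX\<close> with value 1 at
  \<open>\<iota> p\<close>, but it eventually vanishes along the representative of \<open>A\<close>,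
  which leaves every ball; hence the extension is 0 at the limit point.\<close>

lemma cone_limit_point_in_corona:
  assumes A: "A \<in> asymp_cone \<omega> x0" "A \<noteq> cone_base \<omega> x0"
  shows "cone_limit_point \<omega> hX \<iota> A \<in> topspace (corona hX \<iota>)"
proof -
  have "cone_limit_point \<omega> hX \<iota> A \<noteq> \<iota> p" for p
  proof
    assume eq: "cone_limit_point \<omega> hX \<iota> A = \<iota> p"
    obtain F where F: "continuous_map hX euclidean F"
      "\<And>y. F (\<iota> y) = complex_of_real (max 0 (1 - dist p y / 1))"
      using higson_extension[OF bump_higson[OF proper, of 1 p x0]] by auto
    have "eventually (\<lambda>n. dist p x0 + 1 \<le> dist ((SOME x. x \<in> A) n) x0) \<omega>"
      by (rule eventually_representative_far[OF A])
    then have "eventually (\<lambda>n. F (\<iota> ((SOME x. x \<in> A) n)) = 0) \<omega>"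
    proof eventually_elim
      case (elim n)
      then have "1 \<le> dist p ((SOME x. x \<in> A) n)"
        using dist_triangle[of "(SOME x. x \<in> A) n" x0 p] by (simp add: dist_commute)
      then show ?case by (simp add: F(2))
    qed
    then have "((\<lambda>n. F (\<iota> ((SOME x. x \<in> A) n))) \<longlongrightarrow> 0) \<omega>" by (rule tendsto_eventually)
    then have "F (\<iota> p) = 0"
      using tendsto_cone_limit_point[OF F(1), of A] uf tendsto_unique
      unfolding eq ultrafilter_def by blast
    then show False by (simp add: F(2))
  qed
  then show ?thesis
    using limitin_topspace[OF limitin_cone_limit_point] by (auto simp: corona_def)
qed

text \<open>Slow variation passes to the limit along \<open>\<omega>\<close>: if the cone distance
  to \<open>B\<close> is small against the norm of \<open>A\<close>, then eventually so are the
  distances of the terms against the norms of the terms.\<close>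

lemma cone_limit_point_continuous_at:
  assumes F: "continuous_map hX euclidean F" and A: "A \<in> asymp_cone \<omega> x0" "A \<noteq> cone_base \<omega> x0"
    and \<epsilon>: "\<epsilon> > 0"
  shows "\<exists>\<delta>>0. \<forall>B\<in>asymp_cone \<omega> x0. cone_dist \<omega> x0 A B < \<delta> \<longrightarrow>
    cmod (F (cone_limit_point \<omega> hX \<iota> A) - F (cone_limit_point \<omega> hX \<iota> B)) \<le> \<epsilon>"
proof -
  let ?x = "\<lambda>A. SOME x. x \<in> A"
  obtain \<delta> R where \<delta>: "\<delta> > 0" and slow: "\<And>x y. R \<le> dist x x0 \<Longrightarrow>
      dist x y \<le> \<delta> * dist x x0 \<Longrightarrow> cmod (F (\<iota> x) - F (\<iota> y)) < \<epsilon>"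
    using continuous_restriction_higson[OF F] \<epsilon> unfolding higson_functions_iff[OF proper] by blast
  let ?c = "cone_dist \<omega> x0 A (cone_base \<omega> x0)"
  have c: "?c > 0" by (rule cone_dist_base_pos[OF A])
  have "cmod (F (cone_limit_point \<omega> hX \<iota> A) - F (cone_limit_point \<omega> hX \<iota> B)) \<le> \<epsilon>"
    if B: "B \<in> asymp_cone \<omega> x0" and d: "cone_dist \<omega> x0 A B < \<delta> * (?c / 2)" for B
  proof (rule tendsto_upperbound)
    show "((\<lambda>n. cmod (F (\<iota> (?x A n)) - F (\<iota> (?x B n)))) \<longlongrightarrow>
        cmod (F (cone_limit_point \<omega> hX \<iota> A) - F (cone_limit_point \<omega> hX \<iota> B))) \<omega>"
      by (intro tendsto_intros tendsto_cone_limit_point F)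
    have "eventually (\<lambda>n. ?c / 2 < dist (?x A n) x0 / real n) \<omega>"
      using c by (intro order_tendstoD(1)[OF cone_dist_base_tendsto[OF A(1)]]) simp
    moreover have "eventually (\<lambda>n. dist (?x A n) (?x B n) / real n < \<delta> * (?c / 2)) \<omega>"
      by (rule order_tendstoD(2)[OF cone_dist_tendsto[OF A(1) B] d])
    moreover note eventually_representative_far[OF A, of R] nonprincipal_pos[OF uf np]
    ultimately show "eventually (\<lambda>n. cmod (F (\<iota> (?x A n)) - F (\<iota> (?x B n))) \<le> \<epsilon>) \<omega>"
    proof eventually_elim
      case (elim n)
      have "dist (?x A n) (?x B n) / real n \<le> \<delta> * (dist (?x A n) x0 / real n)"
        using elim(1,2) mult_left_mono[of "?c / 2" "dist (?x A n) x0 / real n" \<delta>] \<delta> by linarith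
      then have "dist (?x A n) (?x B n) \<le> \<delta> * dist (?x A n) x0"
        using elim(4) by (simp add: divide_le_cancel)
      then show ?case using slow elim(3) by (simp add: less_imp_le)
    qed
    show "\<omega> \<noteq> bot" using uf by (simp add: ultrafilter_def)
  qed
  then show ?thesis using \<delta> c by (intro exI[of _ "\<delta> * (?c / 2)"]) simp
qed

text \<open>A compact Hausdorff space is completely regular, so it suffices to control functions on
  \<open>hX\<close>: one that is 0 at the image of \<open>A\<close> and 1 off \<open>W\<close> stays
  at most 1/2 in absolute value on the image of a small ball, which therefore lies in
  \<open>W\<close>.\<close>

lemma continuous_map_cone_limit_point:
  "continuous_map (subtopology (cone_topology \<omega> x0) (asymp_cone \<omega> x0 - {cone_base \<omega> x0}))
     (corona hX \<iota>) (cone_limit_point \<omega> hX \<iota>)"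
proof -
  interpret M: Metric_space "asymp_cone \<omega> x0" "cone_dist \<omega> x0"
    by (rule Metric_space_cone[OF uf np])
  let ?\<xi> = "cone_limit_point \<omega> hX \<iota>"
  let ?Y = "asymp_cone \<omega> x0 - {cone_base \<omega> x0}"
  have top: "topspace (subtopology M.mtopology ?Y) = ?Y" by auto
  have creg: "completely_regular_space hX"
    using compactification_hX
    by (intro normal_imp_completely_regular_space_A compact_Hausdorff_or_regular_imp_normal_space
        Hausdorff_imp_t1_space) auto
  have "continuous_map (subtopology M.mtopology ?Y) hX ?\<xi>"
    unfolding continuous_map_eq_topcontinuous_at topcontinuous_at_def top
  proof (intro ballI conjI allI impI)
    fix A assume A: "A \<in> ?Y"
    fix W assume W: "openin hX W \<and> ?\<xi> A \<in> W"
    then have "closedin hX (topspace hX - W)" "?\<xi> A \<in> topspace hX - (topspace hX - W)"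
      using openin_subset by auto
    then obtain G :: "'b \<Rightarrow> real" where G: "continuous_map hX (top_of_set {0..1}) G"
      "G (?\<xi> A) = 0" "G ` (topspace hX - W) \<subseteq> {1}"
      using creg unfolding completely_regular_space_def by meson
    have "continuous_map hX euclidean (complex_of_real \<circ> G)"
      using G(1) by (intro continuous_map_compose[of _ euclideanreal])
        (auto simp: continuous_map_in_subtopology continuous_on_of_real)
    from cone_limit_point_continuous_at[OF this, of A "1 / 2"] A
    obtain \<delta> where \<delta>: "\<delta> > 0" "\<And>B. B \<in> asymp_cone \<omega> x0 \<Longrightarrow> cone_dist \<omega> x0 A B < \<delta> \<Longrightarrow>
        \<bar>G (?\<xi> B)\<bar> \<le> 1 / 2"
      by (auto simp: G(2))
    let ?U = "M.mball A \<delta> \<inter> ?Y"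
    have "openin (subtopology M.mtopology ?Y) ?U" by (auto simp: openin_subtopology)
    moreover have "A \<in> ?U" using A \<delta>(1) by auto
    moreover have "?\<xi> B \<in> W" if "B \<in> ?U" for B
    proof (rule ccontr)
      assume "?\<xi> B \<notin> W"
      then have "G (?\<xi> B) = 1"
        using G(3) limitin_topspace[OF limitin_cone_limit_point[of B]] by blast
      then show False using \<delta>(2)[of B] that by auto
    qed
    ultimately show "\<exists>U. openin (subtopology M.mtopology ?Y) U \<and> A \<in> U \<and> (\<forall>y\<in>U. ?\<xi> y \<in> W)"
      by blast
  qed (auto intro: limitin_topspace[OF limitin_cone_limit_point])
  moreover have "?\<xi> ` ?Y \<subseteq> topspace hX - range \<iota>"
    using cone_limit_point_in_corona by (auto simp: corona_def)
  ultimately show ?thesis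
    unfolding cone_topology_def corona_def continuous_map_in_subtopology top by auto
qed

text \<open>On an annulus, the points at scale \<open>n\<close> have norm comparable to \<open>n\<close>. If the scales are sparse
  enough, only the bump at scale \<open>n\<close> can therefore be nonzero at the \<open>n\<close>-th term of a sequence
  in the annulus.\<close>

lemma cone_annulus_separation:
  assumes expo: "exponential_ultrafilter \<omega>" and D: "D > 0"
    and A: "A \<in> cone_annulus \<omega> x0 D" and r: "r > 0"
  shows "\<exists>F. continuous_map hX (euclidean :: complex topology) F \<and> F (cone_limit_point \<omega> hX \<iota> A) = 1 \<and>
    (\<forall>B\<in>cone_annulus \<omega> x0 D. F (cone_limit_point \<omega> hX \<iota> B) \<noteq> 0 \<longrightarrow> cone_dist \<omega> x0 A B < r)"
proof -
  interpret M: Metric_space "asymp_cone \<omega> x0" "cone_dist \<omega> x0"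
    by (rule Metric_space_cone[OF uf np])
  let ?x = "\<lambda>A. SOME x. x \<in> A"
  have bot: "\<omega> \<noteq> bot" using uf by (simp add: ultrafilter_def)
  \<comment> \<open>The slack factor 2 on either side turns bounds on the limit into eventual bounds
    on the terms.\<close>
  define c where "c = 1 / (2 * D)"
  define C where "C = 2 * D"
  have c: "c > 0" using D by (simp add: c_def)
  have norm: "eventually (\<lambda>n. c * real n \<le> dist (?x B n) x0 \<and> dist (?x B n) x0 \<le> C * real n) \<omega>"
    and cone: "B \<in> asymp_cone \<omega> x0" if B: "B \<in> cone_annulus \<omega> x0 D" for B
  proof -
    show BM: "B \<in> asymp_cone \<omega> x0" using B by (auto simp: cone_annulus_def)
    have d: "1 / D \<le> cone_dist \<omega> x0 B (cone_base \<omega> x0)" "cone_dist \<omega> x0 B (cone_base \<omega> x0) \<le> D"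
      using B by (auto simp: cone_annulus_def M.commute)
    have "c < 1 / D" using D by (simp add: c_def field_simps)
    then have "eventually (\<lambda>n. c < dist (?x B n) x0 / real n) \<omega>"
      using d by (intro order_tendstoD(1)[OF cone_dist_base_tendsto[OF BM]]) simp
    moreover have "eventually (\<lambda>n. dist (?x B n) x0 / real n < C) \<omega>"
      using d D by (intro order_tendstoD(2)[OF cone_dist_base_tendsto[OF BM]]) (simp add: C_def)
    moreover note nonprincipal_pos[OF uf np]
    ultimately show "eventually (\<lambda>n. c * real n \<le> dist (?x B n) x0 \<and> dist (?x B n) x0 \<le> C * real n) \<omega>"
      by eventually_elim (simp add: field_simps)
  qed
  \<comment> \<open>\<open>e < r\<close> yields the strict conclusion; \<open>e \<le> c / 2\<close>
    keeps the radius of each bump at most half the norm of its centre.\<close>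
  define e where "e = min r c / 2"
  have e: "e > 0" "e < r" "e \<le> c / 2" using r c by (auto simp: e_def min_def)
  \<comment> \<open>With ratio \<open>2 * C / c\<close>, the largest norm at scale \<open>m\<close>
    is at most half the smallest norm at any later scale \<open>n\<close>.\<close>
  obtain S0 where S0: "eventually (\<lambda>n. n \<in> S0) \<omega>"
    "\<And>m n. m \<in> S0 \<Longrightarrow> n \<in> S0 \<Longrightarrow> m < n \<Longrightarrow> 2 * C / c * real m \<le> real n"
    using exponential_ultrafilter_sparse[OF expo] by meson
  \<comment> \<open>The norm bounds hold only eventually; restricting to the scales where they hold
    makes them valid for every centre.\<close>
  define S where "S = {n \<in> S0. n \<ge> 1 \<and> c * real n \<le> dist (?x A n) x0 \<and> dist (?x A n) x0 \<le> C * real n}"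
  have evS: "eventually (\<lambda>n. n \<in> S) \<omega>"
    using S0(1) nonprincipal_pos[OF uf np] norm[OF A]
    by eventually_elim (simp add: S_def)
  have S: "S \<noteq> {}" using eventually_happens'[OF bot evS] by blast
  have sparse: "2 * C * real m \<le> c * real n" if "m \<in> S" "n \<in> S" "m < n" for m n
    using S0(2)[of m n] that c by (simp add: S_def field_simps)
  have hig: "(\<lambda>x. complex_of_real (scaled_bumps S (?x A) e x)) \<in> higson_functions x0"
    by (rule scaled_bumps_higson[OF proper S _ _ e(1), where C=C]) (simp_all add: S_def)
  obtain F where F: "continuous_map hX euclidean F"
    "\<And>x. F (\<iota> x) = complex_of_real (scaled_bumps S (?x A) e x)"
    using higson_extension[OF hig] by blast
  have "((\<lambda>n. F (\<iota> (?x A n))) \<longlongrightarrow> 1) \<omega>"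
    by (rule tendsto_eventually, use evS in eventually_elim)
       (simp add: F(2) scaled_bumps_center e(1))
  then have "F (cone_limit_point \<omega> hX \<iota> A) = 1"
    using tendsto_cone_limit_point[OF F(1), of A] bot tendsto_unique by blast
  moreover have "cone_dist \<omega> x0 A B < r"
    if B: "B \<in> cone_annulus \<omega> x0 D" and nz: "F (cone_limit_point \<omega> hX \<iota> B) \<noteq> 0" for B
  proof -
    have "eventually (\<lambda>n. F (\<iota> (?x B n)) \<noteq> 0) \<omega>"
      by (rule tendsto_imp_eventually_ne[OF tendsto_cone_limit_point[OF F(1)] nz])
    with evS norm[OF B] have "eventually (\<lambda>n. dist (?x A n) (?x B n) / real n \<le> e) \<omega>"
    proof eventually_elim
      case (elim n)
      have "dist (?x B n) (?x A n) < e * real n"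
      proof (rule ccontr)
        assume nn: "\<not> dist (?x B n) (?x A n) < e * real n"
        have "e * real m \<le> dist (?x B n) (?x A m)" if m: "m \<in> S" for m
        proof -
          have cm: "c * real m \<le> dist (?x A m) x0" "dist (?x A m) x0 \<le> C * real m"
            using m by (auto simp: S_def)
          have em: "e * real m \<le> c / 2 * real m" using e(3) by (rule mult_right_mono) simp
          consider "m = n" | "m < n" | "n < m" by linarith
          then show ?thesis
          proof cases
            case 1
            then show ?thesis using nn by simp
          next
            \<comment> \<open>The point has norm at least
              \<open>c * real n \<ge> 2 * C * real m\<close> and the centre at most
              \<open>C * real m\<close>, so they are at least
              \<open>C * real m \<ge> e * real m\<close> apart.\<close>
            case 2
            have "c * real n \<le> dist (?x B n) (?x A m) + C * real m"
              using elim(2) cm dist_triangle[of "?x B n" x0 "?x A m"] by linarith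
            moreover have "0 \<le> c * real m" using c by simp
            ultimately show ?thesis using sparse[OF m elim(1) 2] em cm by linarith
          next
            \<comment> \<open>Now the centre is the far one: its norm is at least
              \<open>c * real m\<close>, and that of the point is at most half of this, so at least
              \<open>c / 2 * real m\<close> remains.\<close>
            case 3
            have "c * real m \<le> dist (?x B n) (?x A m) + C * real n"
              using elim(2) cm dist_triangle3[of "?x A m" x0 "?x B n"] by (simp add: dist_commute)
            then show ?thesis using sparse[OF elim(1) m 3] em by linarith
          qed
        qed
        then have "scaled_bumps S (?x A) e (?x B n) = 0"
          by (intro scaled_bumps_eq_0[OF e(1) S]) (auto simp: S_def)
        then show False using elim(3) by (simp add: F(2))
      qed
      then show ?case
        using elim(1) by (simp add: S_def dist_commute divide_le_eq)
    qed
    then have "cone_dist \<omega> x0 A B \<le> e"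
      by (rule tendsto_upperbound[OF cone_dist_tendsto[OF cone[OF A] cone[OF B]] _ bot])
    then show ?thesis using e(2) by linarith
  qed
  ultimately show ?thesis using F(1) by blast
qed

end

end

section \<open>Injectivity of the map and embedding of the annuli\<close>

theorem theorem5p1:
  fixes \<omega> :: "nat filter"
    and x0 :: "'a::metric_space"
    and hX :: "'b topology"
    and \<iota> :: "'a \<Rightarrow> 'b"
  assumes "exponential_ultrafilter \<omega>"
    and "\<forall>S :: 'a set. closed S \<and> bounded S \<longrightarrow> compact S"
    and "sublinear_higson_compactification x0 hX \<iota>"
  shows "\<exists>\<xi>. continuous_map
               (subtopology (cone_topology \<omega> x0) (asymp_cone \<omega> x0 - {cone_base \<omega> x0}))
               (corona hX \<iota>) \<xi> \<and>
             inj_on \<xi> (asymp_cone \<omega> x0 - {cone_base \<omega> x0}) \<and>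
             (\<forall>D>0. embedding_map
               (subtopology (cone_topology \<omega> x0) (cone_annulus \<omega> x0 D)) (corona hX \<iota>) \<xi>)"
proof -
  have uf: "ultrafilter \<omega>" and np: "nonprincipal \<omega>"
    using assms(1) by (auto simp: exponential_ultrafilter_def)
  interpret M: Metric_space "asymp_cone \<omega> x0" "cone_dist \<omega> x0"
    by (rule Metric_space_cone[OF uf np])
  let ?\<xi> = "cone_limit_point \<omega> hX \<iota>"
  let ?Y = "asymp_cone \<omega> x0 - {cone_base \<omega> x0}"
  note sep = cone_annulus_separation[OF uf np assms(2,3,1)]
  have cont: "continuous_map (subtopology (cone_topology \<omega> x0) ?Y) (corona hX \<iota>) ?\<xi>"
    by (rule continuous_map_cone_limit_point[OF uf np assms(2,3)])
  have annY: "cone_annulus \<omega> x0 D \<subseteq> ?Y" if "D > 0" for D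
    using that by (auto simp: cone_annulus_def)
  have inj_ann: "inj_on ?\<xi> (cone_annulus \<omega> x0 D)" if D: "D > 0" for D
  proof (rule inj_onI, rule ccontr)
    fix A B assume A: "A \<in> cone_annulus \<omega> x0 D" and B: "B \<in> cone_annulus \<omega> x0 D"
      and eq: "?\<xi> A = ?\<xi> B" and "A \<noteq> B"
    then have r: "cone_dist \<omega> x0 A B > 0"
      using annY[OF D] by (intro M.mdist_pos_less) auto
    \<comment> \<open>With the distance of \<open>A\<close> and \<open>B\<close> as radius, the
      separating function would have to vanish at the image of \<open>B\<close>, but there it is
      1.\<close>
    obtain F :: "'b \<Rightarrow> complex" where "F (?\<xi> A) = 1"
      "\<forall>B\<in>cone_annulus \<omega> x0 D. F (?\<xi> B) \<noteq> 0 \<longrightarrow> cone_dist \<omega> x0 A B < cone_dist \<omega> x0 A B"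
      using sep[OF D A r] B eq by (metis less_irrefl zero_neq_one)
    then show False using B eq by auto
  qed
  have inj: "inj_on ?\<xi> ?Y"
  proof (rule inj_onI)
    fix A B assume A: "A \<in> ?Y" and B: "B \<in> ?Y" and eq: "?\<xi> A = ?\<xi> B"
    let ?a = "cone_dist \<omega> x0 A (cone_base \<omega> x0)" and ?b = "cone_dist \<omega> x0 B (cone_base \<omega> x0)"
    have pos: "?a > 0" "?b > 0"
      using A B cone_dist_base_pos[OF uf np] by auto
    \<comment> \<open>Dominating both norms and their reciprocals puts both points into one
      annulus.\<close>
    define D where "D = ?a + ?b + 1 / ?a + 1 / ?b"
    have pos': "1 / ?a > 0" "1 / ?b > 0" using pos by auto
    have D: "D > 0" "?a \<le> D" "?b \<le> D" "1 / ?a \<le> D" "1 / ?b \<le> D"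
      using pos pos' unfolding D_def by linarith+
    then have "1 / D \<le> ?a" "1 / D \<le> ?b"
      using pos by (auto simp: field_simps)
    then have "A \<in> cone_annulus \<omega> x0 D" "B \<in> cone_annulus \<omega> x0 D"
      using A B D cone_base_in[OF uf np, of x0] by (auto simp: cone_annulus_def M.commute)
    then show "A = B" using inj_ann[OF D(1)] eq by (meson inj_onD)
  qed
  have "embedding_map (subtopology (cone_topology \<omega> x0) (cone_annulus \<omega> x0 D)) (corona hX \<iota>) ?\<xi>"
    if D: "D > 0" for D
  proof -
    let ?A = "cone_annulus \<omega> x0 D"
    let ?X = "subtopology (cone_topology \<omega> x0) ?A"
    let ?I = "subtopology (corona hX \<iota>) (?\<xi> ` ?A)"
    have top: "topspace ?X = ?A"
      using annY[OF D] by (auto simp: cone_topology_def)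
    have "continuous_map ?X (corona hX \<iota>) ?\<xi>"
      using continuous_map_from_subtopology_mono[OF cont annY[OF D]] .
    then have contI: "continuous_map ?X ?I ?\<xi>"
      by (simp add: continuous_map_in_subtopology top)
    have topI: "topspace ?I = ?\<xi> ` ?A"
      using annY[OF D] cone_limit_point_in_corona[OF uf np assms(2,3)] by auto
    \<comment> \<open>Continuity of the inverse is shown as openness onto the image: the set where
      the separating function is nonzero is a neighbourhood of the image of \<open>A\<close>, and
      within the image of the annulus it contains only images of points of the ball.\<close>
    have "open_map ?X ?I ?\<xi>"
      unfolding open_map_def
    proof (intro allI impI)
      fix U assume U: "openin ?X U"
      then obtain V where V: "openin M.mtopology V" "U = V \<inter> ?A"
        by (auto simp: openin_subtopology cone_topology_def)
      show "openin ?I (?\<xi> ` U)"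
      proof (subst openin_subopen, intro ballI)
        fix p assume "p \<in> ?\<xi> ` U"
        then obtain A where A: "A \<in> U" "p = ?\<xi> A" by blast
        then obtain r where r: "r > 0" "M.mball A r \<subseteq> V"
          using V by (auto simp: M.openin_mtopology)
        have "A \<in> ?A" using A V by blast
        then obtain F :: "'b \<Rightarrow> complex" where F: "continuous_map hX euclidean F" "F (?\<xi> A) = 1"
          "\<forall>B\<in>?A. F (?\<xi> B) \<noteq> 0 \<longrightarrow> cone_dist \<omega> x0 A B < r"
          using sep[OF D _ r(1)] by blast
        have "continuous_map ?I euclidean F"
          unfolding corona_def by (intro continuous_map_from_subtopology F(1))
        then have "openin ?I {q \<in> topspace ?I. F q \<in> - {0}}"
          by (rule openin_continuous_map_preimage) auto
        moreover have "p \<in> {q \<in> topspace ?I. F q \<in> - {0}}"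
          unfolding topI using A \<open>A \<in> ?A\<close> F(2) by auto
        moreover have "{q \<in> topspace ?I. F q \<in> - {0}} \<subseteq> ?\<xi> ` U"
        proof
          fix q assume q: "q \<in> {q \<in> topspace ?I. F q \<in> - {0}}"
          then obtain B where B: "B \<in> ?A" "q = ?\<xi> B" unfolding topI by blast
          then have "B \<in> M.mball A r"
            using q F(3) annY[OF D] \<open>A \<in> ?A\<close> by auto
          then show "q \<in> ?\<xi> ` U" using B r V by blast
        qed
        ultimately show "\<exists>T. openin ?I T \<and> p \<in> T \<and> T \<subseteq> ?\<xi> ` U" by blast
      qed
    qed
    then show ?thesis
      unfolding embedding_map_def top
      using contI inj_ann[OF D] topI top by (intro bijective_open_imp_homeomorphic_map) auto
  qed
  with cont inj show ?thesis by blast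
qed

end
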